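(* Let $n\in\mathbb{N}$ and $\epsilon>0$ be given, and let $G_{ph}=([n],E_{ph})$ be a complete $r$-partite graph (with all self-loops) for some $r\in[n]$. Then $k^*_\epsilon(G_{ph})<\infty$.
   Context: Social Hegselmann-Krause (HK) dynamics: there are $n$ agents, with $[n]=\{1,\dots,n\}$, and a fixed confidence bound $R>0$. The physical connectivity graph $G_{ph}=([n],E_{ph})$ is an undirected, time-invariant graph containing all self-loops. The state at time $k=0,1,2,\dots$ is $x[k]\in\mathbb{R}^n$. The influence graph $\tilde G[k]$ has vertex set $[n]$ and has the edge $(i,j)$ iff $(i,j)\in E_{ph}$ and $|x_i[k]-x_j[k]|\le R$. The update rule is $x_i[k+1]=\frac{1}{|\mathcal N_i[k]|}\sum_{j\in\mathcal N_i[k]}x_j[k]$, where $\mathcal N_i[k]$ is the set of neighbors of $i$ in $\tilde G[k]$ (including $i$ itself). For every initial state $x[0]=x_0$ the limit (steady state) $x_\infty(x_0):=\lim_{k\to\infty}x[k]$ exists. For $\epsilon>0$, $k_\epsilon(G_{ph},x_0):=\inf\{N\in\mathbb{N}:\|x[k]-x_\infty(x_0)\|<\epsilon\text{ for all }k\ge N\}$ (Euclidean norm), and $k_\epsilon^*(G_{ph}):=\sup_{x_0\in\mathbb{R}^n}k_\epsilon(G_{ph},x_0)$. A graph on $[n]$ is complete $r$-partite if $[n]$ is partitioned into non-empty sets $V_1,\dots,V_r$ such that two distinct vertices are adjacent iff they lie in different parts; in addition every vertex has a self-loop. *)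

theory Defs
  imports "HOL-Analysis.Analysis" "HOL-Library.Extended_Nat" "HOL-Library.Disjoint_Sets"
begin

text \<open>
  Agents are the elements of a finite type \<open>'n\<close>, so \<open>CARD('n)\<close> is the number of agents
  and a state is a vector in \<open>real ^ 'n\<close>. A graph on the agents is given by its edge
  relation; an undirected graph is a symmetric relation.
\<close>

definition complete_partite :: "nat \<Rightarrow> ('n::finite \<times> 'n) set \<Rightarrow> bool" where
  "complete_partite r E \<longleftrightarrow>
     (\<exists>P. partition_on UNIV P \<and> card P = r \<and>
        (\<forall>i j. i \<noteq> j \<longrightarrow> ((i, j) \<in> E \<longleftrightarrow> \<not> (\<exists>V\<in>P. i \<in> V \<and> j \<in> V))) \<and>
        (\<forall>i. (i, i) \<in> E))"

lemma complete_partite_refl: "complete_partite r E \<Longrightarrow> refl E"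
  by (auto simp: complete_partite_def refl_on_def)

lemma complete_partite_sym: "complete_partite r E \<Longrightarrow> sym E"
  unfolding complete_partite_def sym_def by metis

definition influence_graph ::
    "real \<Rightarrow> ('n::finite \<times> 'n) set \<Rightarrow> real ^ 'n \<Rightarrow> ('n \<times> 'n) set" where
  "influence_graph R E x = {(i, j). (i, j) \<in> E \<and> \<bar>x $ i - x $ j\<bar> \<le> R}"

definition neighbours ::
    "real \<Rightarrow> ('n::finite \<times> 'n) set \<Rightarrow> real ^ 'n \<Rightarrow> 'n \<Rightarrow> 'n set" where
  "neighbours R E x i = {j. (i, j) \<in> influence_graph R E x}"

definition hk_update ::
    "real \<Rightarrow> ('n::finite \<times> 'n) set \<Rightarrow> real ^ 'n \<Rightarrow> real ^ 'n" where
  "hk_update R E x =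
     (\<chi> i. (1 / real (card (neighbours R E x i))) * (\<Sum>j\<in>neighbours R E x i. x $ j))"

definition hk_state ::
    "real \<Rightarrow> ('n::finite \<times> 'n) set \<Rightarrow> real ^ 'n \<Rightarrow> nat \<Rightarrow> real ^ 'n" where
  "hk_state R E x0 k = (hk_update R E ^^ k) x0"

definition steady_state ::
    "real \<Rightarrow> ('n::finite \<times> 'n) set \<Rightarrow> real ^ 'n \<Rightarrow> real ^ 'n" where
  "steady_state R E x0 = lim (hk_state R E x0)"

text \<open>
  Times are extended naturals: the infimum of the empty set and the supremum of an
  unbounded set are \<open>\<infinity>\<close>.
\<close>

definition convergence_time ::
    "real \<Rightarrow> real \<Rightarrow> ('n::finite \<times> 'n) set \<Rightarrow> real ^ 'n \<Rightarrow> enat" where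
  "convergence_time R \<epsilon> E x0 =
     Inf (enat ` {N. \<forall>k\<ge>N. norm (hk_state R E x0 k - steady_state R E x0) < \<epsilon>})"

definition max_convergence_time ::
    "real \<Rightarrow> real \<Rightarrow> ('n::finite \<times> 'n) set \<Rightarrow> enat" where
  "max_convergence_time R \<epsilon> E = (SUP x0. convergence_time R \<epsilon> E x0)"

end

theory Submission
  imports Defs "HOL-Computational_Algebra.Polynomial"
begin

text \<open>
  Three facts together bound the convergence time uniformly in the initial state.

  \<^item> Energy. Let every physical link contribute its squared length, truncated at \<open>R\<^sup>2\<close>. This energy
  is at most \<open>card E * R\<^sup>2\<close>, and it drops by at least four times the sum of the squared displacements
  in every step (\<open>hk_energy_drop\<close>). So the number of steps in which some agent moves by more than a
  given \<open>\<delta>\<close> is bounded, whatever the initial state, and for each length \<open>L\<close> a window of \<open>L\<close>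
  consecutive quiet steps occurs by a time that depends on \<open>L\<close> and \<open>\<delta>\<close> only (\<open>quiet_window\<close>).

  \<^item> Geometry. In a quiet step all influence links are very short (\<open>edge_length_le_step\<close>). Since the
  physical graph is complete multipartite, the agents then fall into tight clusters, and inside each
  cluster two agents are linked exactly if they lie in different parts (\<open>short_edges_imp_clusters\<close>).
  Between two consecutive quiet steps the influence graph cannot change, because a link that
  appears or disappears would have to have a length close to \<open>R\<close>.

  \<^item> Rigidity. What remains to be excluded is that two clusters rest at a distance slightly above \<open>R\<close>
  and drift into each other's range after an arbitrarily long quiet period. While the influence
  graph is constant, the dynamics is linear, and for every pair of clusters the largest signed
  difference \<open>x i - x j\<close> between an agent of the first and an agent of the second cluster in
  different parts is attained by a time \<open>K\<close> that depends on the graph only (\<open>pair_gap_attained\<close>).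
  So an influence graph of tight clusters that is constant during \<open>K + 1\<close> states is constant forever (\<open>static_forever\<close>), and every
  agent stays within the tiny convex hull of its cluster.

  Rigidity rests on a sign property of complete multipartite graphs. The vector of part averages in a
  cluster evolves by a matrix all of whose eigenvalues except the simple eigenvalue 1 are real and
  at most 0. Dividing the characteristic polynomial by \<open>t - 1\<close> hence leaves a polynomial with
  nonnegative coefficients, and it annihilates the deviations of the part averages from their
  limit (\<open>cluster_poly_annihilates\<close>). A sequence of constant sign that satisfies a nontrivial linear
  recurrence with nonnegative coefficients vanishes eventually. Hence the gaps cannot approach their
  limit from one side only, and compactness of the unit sphere turns this into the uniform time \<open>K\<close>
  (\<open>vanishing_functionals_sup_attained\<close>).
\<close>

section \<open>Averaging over neighbourhoods\<close>

definition local_mean :: "('n::finite \<times> 'n) set \<Rightarrow> real ^ 'n \<Rightarrow> real ^ 'n" where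
  "local_mean G x = (\<chi> i. (1 / real (card (G `` {i}))) * (\<Sum>j\<in>G `` {i}. x $ j))"

definition edge_energy :: "('n::finite \<times> 'n) set \<Rightarrow> real ^ 'n \<Rightarrow> real" where
  "edge_energy G x = (\<Sum>(i, j)\<in>G. (x $ i - x $ j)\<^sup>2)"

lemma hk_update_eq_local_mean: "hk_update R E x = local_mean (influence_graph R E x) x"
  by (simp add: hk_update_def local_mean_def neighbours_def Image_singleton)

lemma sum_over_edges: "(\<Sum>(i, j)\<in>G. f i j) = (\<Sum>i\<in>UNIV. \<Sum>j\<in>G `` {i}. f i j)"
  for G :: "('n::finite \<times> 'n) set"
proof -
  have "(\<Sum>i\<in>UNIV. \<Sum>j\<in>G `` {i}. f i j) = (\<Sum>(i, j)\<in>Sigma UNIV (\<lambda>i. G `` {i}). f i j)"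
    by (rule sum.Sigma) auto
  also have "Sigma UNIV (\<lambda>i. G `` {i}) = G" by auto
  finally show ?thesis ..
qed

lemma sum_edges_swap:
  assumes "sym G"
  shows "(\<Sum>(i, j)\<in>G. f i j) = (\<Sum>(i, j)\<in>G. f j i)"
  by (rule sum.reindex_bij_witness[where i = prod.swap and j = prod.swap])
    (use assms in \<open>auto dest: symD\<close>)

lemma degree_pos:
  fixes G :: "('n::finite \<times> 'n) set"
  assumes "refl G"
  shows "0 < card (G `` {i})"
  using assms by (auto simp: card_gt_0_iff dest: reflD)

lemma degree_times_step:
  assumes "refl G"
  shows "real (card (G `` {i})) * (x $ i - local_mean G x $ i) = (\<Sum>j\<in>G `` {i}. x $ i - x $ j)"
  using degree_pos[OF assms, of i] by (simp add: local_mean_def sum_subtractf right_diff_distrib)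

text \<open>
  With \<open>u\<close> the displacement and \<open>d\<close> the degree, expanding the square gives the terms
  \<open>-4 * d i * (u i)\<^sup>2\<close> from the cross products and at most \<open>4 * (d i - 1) * (u i)\<^sup>2\<close> from the squares of
  \<open>u i - u j\<close>. The difference, one \<open>4 * (u i)\<^sup>2\<close> per agent, is due to the self-loops.
\<close>

lemma edge_energy_drop:
  fixes G :: "('n::finite \<times> 'n) set"
  assumes "sym G" "refl G"
  shows "edge_energy G (local_mean G x) + 4 * (\<Sum>i\<in>UNIV. (x $ i - local_mean G x $ i)\<^sup>2)
    \<le> edge_energy G x"
proof -
  define u where "u i = x $ i - local_mean G x $ i" for i
  define d where "d i = real (card (G `` {i}))" for i
  have degree_sum: "(\<Sum>(i, j)\<in>G. (u i)\<^sup>2) = (\<Sum>i\<in>UNIV. d i * (u i)\<^sup>2)"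
    by (simp add: sum_over_edges d_def)
  have half: "(\<Sum>(i, j)\<in>G. (x $ i - x $ j) * u i) = (\<Sum>i\<in>UNIV. d i * (u i)\<^sup>2)"
    unfolding sum_over_edges
    by (simp add: sum_distrib_right[symmetric] degree_times_step[OF assms(2), symmetric] d_def u_def
        power2_eq_square mult.assoc)
  have "(\<Sum>(i, j)\<in>G. (x $ i - x $ j) * u j) = - (\<Sum>(i, j)\<in>G. (x $ i - x $ j) * u i)"
    by (subst sum_edges_swap[OF assms(1)])
      (simp add: sum_negf[symmetric] case_prod_unfold algebra_simps)
  with half have cross:
    "(\<Sum>(i, j)\<in>G. (x $ i - x $ j) * (u i - u j)) = 2 * (\<Sum>i\<in>UNIV. d i * (u i)\<^sup>2)"
    by (simp add: case_prod_unfold right_diff_distrib sum_subtractf)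
  \<comment> \<open>The bound \<open>(u i - u j)\<^sup>2 \<le> 2 * (u i)\<^sup>2 + 2 * (u j)\<^sup>2\<close> wastes \<open>4 * (u i)\<^sup>2\<close> at a self-loop, which is
    subtracted again.\<close>
  have loops: "(\<Sum>(i, j)\<in>G. if j = i then 4 * (u i)\<^sup>2 else 0) = 4 * (\<Sum>i\<in>UNIV. (u i)\<^sup>2)"
    using assms(2) by (auto simp: sum_over_edges sum_distrib_left dest: reflD intro!: sum.cong)
  have "(\<Sum>(i, j)\<in>G. (u i - u j)\<^sup>2)
      \<le> (\<Sum>(i, j)\<in>G. 2 * (u i)\<^sup>2 + 2 * (u j)\<^sup>2 - (if j = i then 4 * (u i)\<^sup>2 else 0))"
  proof (rule sum_mono, clarify)
    fix i j
    have "0 \<le> (u i + u j)\<^sup>2" by simp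
    then show "(u i - u j)\<^sup>2 \<le> 2 * (u i)\<^sup>2 + 2 * (u j)\<^sup>2 - (if j = i then 4 * (u i)\<^sup>2 else 0)"
      by (auto simp: power2_eq_square algebra_simps)
  qed
  also have "\<dots> = 2 * (\<Sum>(i, j)\<in>G. (u i)\<^sup>2) + 2 * (\<Sum>(i, j)\<in>G. (u j)\<^sup>2)
      - (\<Sum>(i, j)\<in>G. if j = i then 4 * (u i)\<^sup>2 else 0)"
    by (simp add: case_prod_unfold sum.distrib sum_subtractf sum_distrib_left)
  also have "(\<Sum>(i, j)\<in>G. (u j)\<^sup>2) = (\<Sum>(i, j)\<in>G. (u i)\<^sup>2)"
    by (rule sum_edges_swap[OF assms(1)])
  finally have square: "(\<Sum>(i, j)\<in>G. (u i - u j)\<^sup>2)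
      \<le> 4 * (\<Sum>i\<in>UNIV. d i * (u i)\<^sup>2) - 4 * (\<Sum>i\<in>UNIV. (u i)\<^sup>2)"
    by (simp add: degree_sum loops)
  have "(\<Sum>(i, j)\<in>G. (local_mean G x $ i - local_mean G x $ j)\<^sup>2)
      = (\<Sum>(i, j)\<in>G. (x $ i - x $ j)\<^sup>2 - 2 * ((x $ i - x $ j) * (u i - u j)) + (u i - u j)\<^sup>2)"
    by (rule sum.cong) (auto simp: u_def power2_eq_square algebra_simps)
  also have "\<dots> = edge_energy G x - 2 * (\<Sum>(i, j)\<in>G. (x $ i - x $ j) * (u i - u j))
      + (\<Sum>(i, j)\<in>G. (u i - u j)\<^sup>2)"
    by (simp add: edge_energy_def case_prod_unfold sum.distrib sum_subtractf sum_distrib_left)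
  finally show ?thesis using square cross unfolding u_def[symmetric] edge_energy_def by simp
qed

text \<open>
  A cut argument. For the set \<open>U\<close> of agents at or above the upper endpoint, the sum of degree times
  displacement over \<open>U\<close> telescopes to the total length of the edges that leave \<open>U\<close>, and the given edge
  is one of them.
\<close>

lemma edge_length_le_step:
  fixes G :: "('n::finite \<times> 'n) set"
  assumes "sym G" "refl G" "(a, b) \<in> G"
  shows "\<bar>x $ a - x $ b\<bar> \<le> real CARD('n) * (\<Sum>i\<in>UNIV. \<bar>x $ i - local_mean G x $ i\<bar>)"
proof -
  define u where "u i = x $ i - local_mean G x $ i" for i
  have upward: "x $ a - x $ b \<le> real CARD('n) * (\<Sum>i\<in>UNIV. \<bar>u i\<bar>)" if "(a, b) \<in> G" for a b
  proof (cases "x $ b < x $ a")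
    case True
    define U where "U = {i. x $ a \<le> x $ i}"
    have inside: "(\<Sum>(i, j)\<in>G \<inter> U \<times> U. x $ i - x $ j) = 0"
    proof -
      have "sym (G \<inter> U \<times> U)" using assms(1) by (auto simp: sym_def)
      from sum_edges_swap[OF this, of "\<lambda>i j. x $ i - x $ j"]
      show ?thesis by (simp add: case_prod_unfold sum_subtractf)
    qed
    have "x $ a - x $ b = (\<Sum>(i, j)\<in>{(a, b)}. x $ i - x $ j)" by simp
    also have "\<dots> \<le> (\<Sum>(i, j)\<in>G \<inter> U \<times> (- U). x $ i - x $ j)"
      by (rule sum_mono2) (use that True in \<open>auto simp: U_def\<close>)
    also have "\<dots> = (\<Sum>(i, j)\<in>G \<inter> U \<times> (- U). x $ i - x $ j) + (\<Sum>(i, j)\<in>G \<inter> U \<times> U. x $ i - x $ j)"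
      by (simp add: inside)
    also have "\<dots> = (\<Sum>(i, j)\<in>G \<inter> U \<times> (- U) \<union> G \<inter> U \<times> U. x $ i - x $ j)"
      by (rule sum.union_disjoint[symmetric]) auto
    also have "G \<inter> U \<times> (- U) \<union> G \<inter> U \<times> U = Sigma U (\<lambda>i. G `` {i})" by auto
    also have "(\<Sum>(i, j)\<in>Sigma U (\<lambda>i. G `` {i}). x $ i - x $ j)
        = (\<Sum>i\<in>U. real (card (G `` {i})) * u i)"
      by (subst sum.Sigma[symmetric]) (auto simp: degree_times_step[OF assms(2)] u_def)
    also have "\<dots> \<le> (\<Sum>i\<in>U. real CARD('n) * \<bar>u i\<bar>)"
    proof (rule sum_mono)
      fix i
      have "real (card (G `` {i})) * u i \<le> real (card (G `` {i})) * \<bar>u i\<bar>"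
        by (simp add: mult_left_mono)
      also have "\<dots> \<le> real CARD('n) * \<bar>u i\<bar>"
        by (intro mult_right_mono) (auto intro: card_mono)
      finally show "real (card (G `` {i})) * u i \<le> real CARD('n) * \<bar>u i\<bar>" .
    qed
    also have "\<dots> \<le> (\<Sum>i\<in>UNIV. real CARD('n) * \<bar>u i\<bar>)" by (rule sum_mono2) auto
    finally show ?thesis by (simp add: sum_distrib_left)
  next
    case False
    then show ?thesis by (smt (verit) mult_nonneg_nonneg of_nat_0_le_iff sum_nonneg abs_ge_zero)
  qed
  from upward[of a b] upward[of b a] assms(1,3) show ?thesis
    by (auto simp: u_def abs_le_iff dest: symD)
qed

lemma local_mean_between:
  fixes G :: "('n::finite \<times> 'n) set"
  assumes "refl G" "\<And>j. (i, j) \<in> G \<Longrightarrow> lo \<le> x $ j \<and> x $ j \<le> hi"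
  shows "lo \<le> local_mean G x $ i" "local_mean G x $ i \<le> hi"
proof -
  have d: "0 < real (card (G `` {i}))" using degree_pos[OF assms(1)] by simp
  have "real (card (G `` {i})) * lo \<le> (\<Sum>j\<in>G `` {i}. x $ j)"
    by (rule sum_bounded_below) (use assms(2) in auto)
  then show "lo \<le> local_mean G x $ i" using d by (simp add: local_mean_def field_simps)
  have "(\<Sum>j\<in>G `` {i}. x $ j) \<le> real (card (G `` {i})) * hi"
    by (rule sum_bounded_above) (use assms(2) in auto)
  then show "local_mean G x $ i \<le> hi" using d by (simp add: local_mean_def field_simps)
qed

text \<open>
  The energy converges, so its decrements vanish. They dominate the displacements, which in turn
  dominate the edge lengths.
\<close>

lemma edge_difference_tendsto_0:
  fixes G :: "('n::finite \<times> 'n) set"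
  assumes "sym G" "refl G" "(i, j) \<in> G"
  shows "(\<lambda>k. (local_mean G ^^ k) x $ i - (local_mean G ^^ k) x $ j) \<longlonglongrightarrow> 0"
proof -
  define X where "X k = (local_mean G ^^ k) x" for k
  define u where "u k l = X k $ l - X (Suc k) $ l" for k l
  define e where "e k = edge_energy G (X k)" for k
  have drop: "e (Suc k) + 4 * (\<Sum>l\<in>UNIV. (u k l)\<^sup>2) \<le> e k" for k
    using edge_energy_drop[OF assms(1,2), of "X k"] by (simp add: e_def u_def X_def)
  have "decseq e"
    using drop by (intro decseq_SucI) (smt (verit) sum_nonneg zero_le_power2)
  moreover have "0 \<le> e k" for k by (auto simp: e_def edge_energy_def intro: sum_nonneg)
  ultimately obtain l where l: "e \<longlonglongrightarrow> l" using decseq_convergent[of e 0] by metis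
  have "(\<lambda>k. e k - e (Suc k)) \<longlonglongrightarrow> l - l" by (intro tendsto_diff l LIMSEQ_Suc[OF l])
  then have gap: "(\<lambda>k. e k - e (Suc k)) \<longlonglongrightarrow> 0" by simp
  have u0: "(\<lambda>k. u k m) \<longlonglongrightarrow> 0" for m
  proof -
    have "(\<lambda>k. (u k m)\<^sup>2) \<longlonglongrightarrow> 0"
    proof (rule tendsto_sandwich[OF _ _ tendsto_const gap])
      show "\<forall>\<^sub>F k in sequentially. (u k m)\<^sup>2 \<le> e k - e (Suc k)"
      proof (rule always_eventually, rule allI)
        fix k
        have "(u k m)\<^sup>2 \<le> (\<Sum>l\<in>UNIV. (u k l)\<^sup>2)" by (rule member_le_sum) auto
        moreover have "0 \<le> (\<Sum>l\<in>UNIV. (u k l)\<^sup>2)" by (rule sum_nonneg) auto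
        ultimately show "(u k m)\<^sup>2 \<le> e k - e (Suc k)" using drop[of k] by linarith
      qed
    qed auto
    then show ?thesis by simp
  qed
  have "(\<lambda>k. real CARD('n) * (\<Sum>l\<in>UNIV. \<bar>u k l\<bar>)) \<longlonglongrightarrow> real CARD('n) * (\<Sum>l\<in>(UNIV::'n set). \<bar>0\<bar>)"
    by (intro tendsto_mult tendsto_const tendsto_sum tendsto_rabs u0)
  then have "(\<lambda>k. real CARD('n) * (\<Sum>l\<in>UNIV. \<bar>u k l\<bar>)) \<longlonglongrightarrow> 0" by simp
  then show ?thesis
  proof (rule Lim_null_comparison[rotated])
    show "\<forall>\<^sub>F k in sequentially. norm ((local_mean G ^^ k) x $ i - (local_mean G ^^ k) x $ j)
        \<le> real CARD('n) * (\<Sum>l\<in>UNIV. \<bar>u k l\<bar>)"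
      using edge_length_le_step[OF assms] by (simp add: u_def X_def)
  qed
qed

section \<open>Attaining the supremum of a vanishing sequence of functionals\<close>

text \<open>
  For the common kernel \<open>N\<close> of all the functionals, the sign hypothesis says that every vector
  outside \<open>N\<close> makes some functional positive. On the compact unit sphere of the orthogonal complement of \<open>N\<close>
  the positive value has a uniform lower bound that is attained within a bounded time, while the
  functionals of late index are uniformly smaller than this bound. Homogeneity extends the comparison
  to all vectors.
\<close>

lemma vanishing_functionals_sup_attained:
  fixes h :: "'l \<Rightarrow> nat \<Rightarrow> 'v::euclidean_space \<Rightarrow> real"
  assumes fin: "finite L"
    and lin: "\<And>l k. l \<in> L \<Longrightarrow> linear (h l k)"
    and lim: "\<And>l x. l \<in> L \<Longrightarrow> (\<lambda>k. h l k x) \<longlonglongrightarrow> 0"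
    and sgn: "\<And>x. (\<And>l k. l \<in> L \<Longrightarrow> h l k x \<le> 0) \<Longrightarrow> (\<And>l k. l \<in> L \<Longrightarrow> h l k x = 0)"
  shows "\<exists>K. \<forall>x. \<forall>l\<in>L. \<forall>k. \<exists>l'\<in>L. \<exists>k'\<le>K. h l k x \<le> h l' k' x"
proof -
  define N where "N = {x. \<forall>l\<in>L. \<forall>k. h l k x = 0}"
  have "subspace N"
    by (auto simp: subspace_def N_def linear_add[OF lin] linear_cmul[OF lin] linear_0[OF lin])
  define S where "S = {s. norm s = 1 \<and> (\<forall>z\<in>N. orthogonal s z)}"
  have "S = sphere 0 1 \<inter> {s. \<forall>z\<in>N. orthogonal z s}"
    by (auto simp: S_def orthogonal_commute)
  then have "compact S"
    by (simp add: compact_Int_closed closed_subspace subspace_orthogonal_to_vectors)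
  have "\<exists>n. \<forall>s\<in>S. \<exists>l\<in>L. \<exists>k\<le>n. inverse (real (Suc n)) < h l k s"
  proof (rule ccontr)
    assume "\<nexists>n. \<forall>s\<in>S. \<exists>l\<in>L. \<exists>k\<le>n. inverse (real (Suc n)) < h l k s"
    then obtain s where s: "\<And>n. s n \<in> S"
      "\<And>n l k. l \<in> L \<Longrightarrow> k \<le> n \<Longrightarrow> h l k (s n) \<le> inverse (real (Suc n))"
      by (metis not_less)
    from \<open>compact S\<close> s(1) obtain t \<sigma> where t: "t \<in> S" "strict_mono \<sigma>" "(s \<circ> \<sigma>) \<longlonglongrightarrow> t"
      unfolding compact_def by metis
    have le: "h l k t \<le> 0" if "l \<in> L" for l k
    proof (rule tendsto_le[OF sequentially_bot])
      have "(\<lambda>n. inverse (real (Suc n))) \<longlonglongrightarrow> 0" by (rule LIMSEQ_inverse_real_of_nat)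
      from LIMSEQ_subseq_LIMSEQ[OF this t(2)]
      show "(\<lambda>n. inverse (real (Suc (\<sigma> n)))) \<longlonglongrightarrow> 0" by (simp add: o_def)
      show "(\<lambda>n. h l k (s (\<sigma> n))) \<longlonglongrightarrow> h l k t"
        using linear_continuous_at[OF linear_conv_bounded_linear[THEN iffD1, OF lin[OF that]]] t(3)
        by (auto simp: o_def intro: isCont_tendsto_compose)
      show "\<forall>\<^sub>F n in sequentially. h l k (s (\<sigma> n)) \<le> inverse (real (Suc (\<sigma> n)))"
        using eventually_ge_at_top[of k]
        by eventually_elim (meson s(2) that le_trans seq_suble t(2))
    qed
    have "t \<in> N" unfolding N_def using sgn[OF le] by blast
    with t(1) have "orthogonal t t" "norm t = 1" by (auto simp: S_def)
    then show False by (simp add: orthogonal_self)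
  qed
  then obtain n where n: "\<And>s. s \<in> S \<Longrightarrow> \<exists>l\<in>L. \<exists>k\<le>n. inverse (real (Suc n)) < h l k s" by blast
  have "\<forall>\<^sub>F k in sequentially. \<forall>l\<in>L. (\<Sum>b\<in>Basis. \<bar>h l k b\<bar>) < inverse (real (Suc n))"
  proof (rule eventually_ball_finite[OF fin], rule ballI)
    fix l assume "l \<in> L"
    then have "(\<lambda>k. \<Sum>b\<in>Basis. \<bar>h l k b\<bar>) \<longlonglongrightarrow> (\<Sum>b\<in>(Basis::'v set). \<bar>0\<bar>)"
      by (intro tendsto_sum tendsto_rabs lim)
    then show "\<forall>\<^sub>F k in sequentially. (\<Sum>b\<in>Basis. \<bar>h l k b\<bar>) < inverse (real (Suc n))"
      by (rule order_tendstoD) simp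
  qed
  then obtain k0 where k0: "\<And>k l. k0 \<le> k \<Longrightarrow> l \<in> L \<Longrightarrow> (\<Sum>b\<in>Basis. \<bar>h l k b\<bar>) < inverse (real (Suc n))"
    unfolding eventually_sequentially by blast
  have tail: "h l k s \<le> inverse (real (Suc n))" if "k0 \<le> k" "l \<in> L" "s \<in> S" for l k s
  proof -
    have "h l k s = h l k (\<Sum>b\<in>Basis. (s \<bullet> b) *\<^sub>R b)" by (simp add: euclidean_representation)
    also have "\<dots> = (\<Sum>b\<in>Basis. (s \<bullet> b) * h l k b)"
      using lin[OF that(2)] by (simp add: linear_sum linear_cmul)
    also have "\<dots> \<le> (\<Sum>b\<in>Basis. \<bar>h l k b\<bar>)"
    proof (rule sum_mono)
      fix b :: 'v assume "b \<in> Basis"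
      then have "\<bar>s \<bullet> b\<bar> \<le> 1" using Basis_le_norm[of b s] that(3) by (simp add: S_def)
      then have "\<bar>s \<bullet> b\<bar> * \<bar>h l k b\<bar> \<le> 1 * \<bar>h l k b\<bar>" by (intro mult_right_mono) auto
      then show "(s \<bullet> b) * h l k b \<le> \<bar>h l k b\<bar>" by (simp add: abs_mult[symmetric])
    qed
    finally show ?thesis using k0[OF that(1,2)] by simp
  qed
  show ?thesis
  proof (intro exI[of _ "max n k0"] allI ballI)
    fix x l k assume l: "l \<in> L"
    obtain z w where zw: "z \<in> span N" "\<And>v. v \<in> span N \<Longrightarrow> orthogonal w v" "x = z + w"
      by (rule orthogonal_subspace_decomp_exists[of N x]) blast
    have "z \<in> N" using zw(1) \<open>subspace N\<close> by (simp add: span_eq_iff[THEN iffD2])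
    then have xw: "h l k x = h l k w" if "l \<in> L" for l k
      using that by (simp add: zw(3) linear_add[OF lin] N_def)
    show "\<exists>l'\<in>L. \<exists>k'\<le>max n k0. h l k x \<le> h l' k' x"
    proof (cases "k \<le> k0 \<or> w = 0")
      case True
      then show ?thesis
      proof
        assume "k \<le> k0"
        then show ?thesis using l by (intro bexI[of _ l] exI[of _ k]) auto
      next
        assume "w = 0"
        then show ?thesis using l by (auto simp: xw linear_0[OF lin] intro!: bexI[of _ l] exI[of _ 0])
      qed
    next
      case False
      define s where "s = (1 / norm w) *\<^sub>R w"
      have w: "w = norm w *\<^sub>R s" using False by (simp add: s_def)
      have "s \<in> S" using False zw(2)
        by (auto simp: S_def s_def orthogonal_clauses span_base)
      from n[OF this] obtain l' k' where l': "l' \<in> L" "k' \<le> n" "inverse (real (Suc n)) < h l' k' s"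
        by blast
      have "h l k s \<le> h l' k' s" using tail[OF _ l \<open>s \<in> S\<close>, of k] False l'(3) by simp
      then have "norm w * h l k s \<le> norm w * h l' k' s" by (rule mult_left_mono) simp
      then have "h l k w \<le> h l' k' w"
        using linear_cmul[OF lin[OF l], of k "norm w" s] linear_cmul[OF lin[OF l'(1)], of k' "norm w" s]
        by (simp flip: w)
      then show ?thesis using l l'(1,2) by (auto simp: xw intro!: bexI[of _ l'] exI[of _ k'])
    qed
  qed
qed


section \<open>Recurrences with nonnegative coefficients\<close>

text \<open>
  The polynomial \<open>p\<close> in the shift operator, applied to the sequence \<open>f\<close>.
\<close>

definition shift_op :: "'a::comm_semiring_1 poly \<Rightarrow> (nat \<Rightarrow> 'a) \<Rightarrow> nat \<Rightarrow> 'a" where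
  "shift_op p f k = (\<Sum>i\<le>degree p. coeff p i * f (k + i))"

lemma shift_op_upto: "degree p \<le> n \<Longrightarrow> shift_op p f k = (\<Sum>i\<le>n. coeff p i * f (k + i))"
  unfolding shift_op_def by (rule sum.mono_neutral_left) (auto simp: coeff_eq_0)

lemma shift_op_0 [simp]: "shift_op 0 f = (\<lambda>k. 0)"
  by (simp add: shift_op_def fun_eq_iff)

lemma shift_op_pCons: "shift_op (pCons a p) f k = a * f k + shift_op p f (Suc k)"
proof -
  have "shift_op (pCons a p) f k = (\<Sum>i\<le>Suc (degree p). coeff (pCons a p) i * f (k + i))"
    by (rule shift_op_upto) (simp add: degree_pCons_le)
  then show ?thesis by (simp only: sum.atMost_Suc_shift) (simp add: shift_op_def)
qed

lemma shift_op_linear_factor: "shift_op [:a, 1:] f = (\<lambda>k. a * f k + f (Suc k))"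
  by (simp add: shift_op_pCons fun_eq_iff)

lemma shift_op_add: "shift_op (p + q) f k = shift_op p f k + shift_op q f k"
proof -
  define n where "n = max (degree p) (degree q)"
  have "degree (p + q) \<le> n" "degree p \<le> n" "degree q \<le> n"
    by (auto simp: n_def degree_add_le_max)
  then show ?thesis by (simp add: shift_op_upto[of _ n] sum.distrib distrib_right)
qed

lemma shift_op_smult: "shift_op (smult a p) f k = a * shift_op p f k"
  by (subst shift_op_upto[OF degree_smult_le]) (simp add: shift_op_def sum_distrib_left mult.assoc)

lemma shift_op_sum_poly: "shift_op (\<Sum>i\<in>A. p i) f k = (\<Sum>i\<in>A. shift_op (p i) f k)"
  by (induction A rule: infinite_finite_induct) (simp_all add: shift_op_add)

lemma shift_op_mult: "shift_op (p * q) f = shift_op p (shift_op q f)"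
proof
  fix k show "shift_op (p * q) f k = shift_op p (shift_op q f) k"
    by (induction p arbitrary: k)
      (simp_all add: mult_pCons_left shift_op_add shift_op_smult shift_op_pCons)
qed

lemma shift_op_mult_eq_0: "shift_op q f = (\<lambda>k. 0) \<Longrightarrow> shift_op (p * q) f k = 0"
  by (simp add: shift_op_mult) (simp add: shift_op_def)

lemma shift_op_scale: "shift_op p (\<lambda>k. c * f k) k = c * shift_op p f k"
  by (simp add: shift_op_def sum_distrib_left algebra_simps)

lemma shift_op_sum: "shift_op p (\<lambda>k. \<Sum>i\<in>A. f i k) k = (\<Sum>i\<in>A. shift_op p (f i) k)"
  unfolding shift_op_def sum_distrib_left by (rule sum.swap)

lemma shift_op_diff: "shift_op p (\<lambda>k. f k - g k) k = shift_op p f k - shift_op p g k"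
  for p :: "'a::comm_ring_1 poly"
  by (simp add: shift_op_def right_diff_distrib sum_subtractf)

lemma shift_op_tendsto_0:
  fixes p :: "real poly"
  assumes "f \<longlonglongrightarrow> 0"
  shows "shift_op p f \<longlonglongrightarrow> 0"
proof -
  have "(\<lambda>k. \<Sum>i\<le>degree p. coeff p i * f (k + i)) \<longlonglongrightarrow> (\<Sum>i\<le>degree p. coeff p i * 0)"
    by (intro tendsto_sum tendsto_mult tendsto_const LIMSEQ_ignore_initial_segment assms)
  then show ?thesis by (simp add: shift_op_def[abs_def])
qed

definition nonneg_poly :: "real poly \<Rightarrow> bool" where
  "nonneg_poly p \<longleftrightarrow> p \<noteq> 0 \<and> (\<forall>i. 0 \<le> coeff p i)"

lemma nonneg_poly_mult: "nonneg_poly p \<Longrightarrow> nonneg_poly q \<Longrightarrow> nonneg_poly (p * q)"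
  by (auto simp: nonneg_poly_def coeff_mult intro!: sum_nonneg)

lemma nonneg_poly_linear: "0 \<le> a \<Longrightarrow> nonneg_poly [:a, 1:]"
  by (auto simp: nonneg_poly_def coeff_pCons split: nat.split)

lemma nonneg_poly_1: "nonneg_poly 1"
  by (auto simp: nonneg_poly_def)

lemma nonneg_poly_prod: "(\<And>i. i \<in> A \<Longrightarrow> nonneg_poly (p i)) \<Longrightarrow> nonneg_poly (prod p A)"
  by (induction A rule: infinite_finite_induct) (auto intro: nonneg_poly_mult nonneg_poly_1)

lemma nonneg_poly_smult: "nonneg_poly p \<Longrightarrow> 0 < c \<Longrightarrow> nonneg_poly (smult c p)"
  by (auto simp: nonneg_poly_def)

lemma nonneg_poly_sum:
  assumes "finite A" "A \<noteq> {}" "\<And>i. i \<in> A \<Longrightarrow> nonneg_poly (p i)"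
  shows "nonneg_poly (sum p A)"
proof -
  obtain a where a: "a \<in> A" using assms(2) by blast
  then obtain k where k: "coeff (p a) k \<noteq> 0"
    using assms(3) by (metis nonneg_poly_def leading_coeff_0_iff)
  then have "0 < coeff (p a) k" using assms(3)[OF a] by (simp add: nonneg_poly_def less_le)
  also have "\<dots> \<le> coeff (sum p A) k"
    unfolding coeff_sum using assms a by (intro member_le_sum) (auto simp: nonneg_poly_def)
  finally have "sum p A \<noteq> 0" by auto
  with assms(3) show ?thesis by (auto simp: nonneg_poly_def coeff_sum intro: sum_nonneg)
qed

text \<open>
  The recurrence writes \<open>0\<close> as a sum of nonpositive terms, so each of them vanishes, in particular
  the one with the lowest nonzero coefficient.
\<close>

lemma nonpos_recurrent_imp_0:
  fixes f :: "nat \<Rightarrow> real"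
  assumes "nonneg_poly p" and m: "m = (LEAST i. coeff p i \<noteq> 0)"
    and rec: "\<And>k. shift_op p f k = 0"
    and nonpos: "\<And>k. m \<le> k \<Longrightarrow> f k \<le> 0" and "m \<le> k"
  shows "f k = 0"
proof -
  have "\<exists>i. coeff p i \<noteq> 0" using assms(1) by (metis nonneg_poly_def leading_coeff_0_iff)
  from LeastI_ex[OF this] have cm: "coeff p m \<noteq> 0" by (simp add: m)
  have low: "coeff p i = 0" if "i < m" for i using not_less_Least that m by blast
  have "(\<Sum>i\<le>degree p. - (coeff p i * f (k - m + i))) = 0"
    using rec[of "k - m"] by (simp add: shift_op_def sum_negf)
  moreover have "0 \<le> - (coeff p i * f (k - m + i))" for i
    using low[of i] nonpos[of "k - m + i"] assms(1,5)
    by (cases "i < m") (auto simp: nonneg_poly_def intro: mult_nonneg_nonpos)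
  ultimately have "\<forall>i\<in>{..degree p}. - (coeff p i * f (k - m + i)) = 0"
    by (subst (asm) sum_nonneg_eq_0_iff) auto
  moreover have "m \<le> degree p" using cm le_degree by blast
  ultimately have "coeff p m * f (k - m + m) = 0" by simp
  then show ?thesis using cm assms(5) by simp
qed

text \<open>
  The first factor is the characteristic polynomial of the averages divided by \<open>t - 1\<close>, up to a factor
  with nonnegative coefficients: agents rather than parts index the products, so each part is
  counted with multiplicity. The second factor passes from the sum of the averages to each single average.
\<close>

definition cluster_poly :: "'a set \<Rightarrow> ('a \<Rightarrow> real) \<Rightarrow> real poly" where
  "cluster_poly A \<nu> = (\<Sum>i\<in>A. smult (1 / real (card A)) (\<Prod>u\<in>A - {i}. [:\<nu> u, 1:])) * (\<Prod>u\<in>A. [:\<nu> u, 1:])"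

lemma nonneg_cluster_poly:
  assumes "finite A" "A \<noteq> {}" "\<And>i. i \<in> A \<Longrightarrow> 0 \<le> \<nu> i"
  shows "nonneg_poly (cluster_poly A \<nu>)"
  unfolding cluster_poly_def using assms
  by (auto intro!: nonneg_poly_mult nonneg_poly_sum nonneg_poly_smult nonneg_poly_prod nonneg_poly_linear
      simp: card_gt_0_iff)

text \<open>
  Write \<open>T\<close> for the shift and \<open>S\<close> for the sum of the \<open>Y i\<close>. From \<open>(T + \<nu> i) (Y i) = S / d i\<close>,
  multiplication with the remaining factors and summation yield a secular equation for \<open>S\<close>. Since
  \<open>1 / (d i * (1 + \<nu> i))\<close> sums to \<open>1\<close>, the number \<open>1\<close> is a root of its polynomial, and the quotient by
  \<open>t - 1\<close> is \<open>\<Sum>i\<in>A. (1 / card A) * (\<Prod>u\<in>A - {i}. t + \<nu> u)\<close>, visibly with nonnegative coefficients. Applied to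
  \<open>S\<close>, the quotient gives a constant sequence, which is \<open>0\<close> because \<open>S\<close> tends to \<open>0\<close>.
\<close>

lemma cluster_poly_annihilates:
  fixes Y :: "'a \<Rightarrow> nat \<Rightarrow> real"
  assumes A: "finite A" "A \<noteq> {}"
    and deg: "\<And>i. i \<in> A \<Longrightarrow> d i * (1 + \<nu> i) = real (card A)"
    and step: "\<And>i k. i \<in> A \<Longrightarrow> d i * (Y i (Suc k) + \<nu> i * Y i k) = (\<Sum>j\<in>A. Y j k)"
    and lim: "\<And>i. i \<in> A \<Longrightarrow> Y i \<longlonglongrightarrow> 0"
    and i: "i \<in> A"
  shows "shift_op (cluster_poly A \<nu>) (Y i) k = 0"
proof -
  define S where "S k = (\<Sum>j\<in>A. Y j k)" for k
  define m where "m = real (card A)"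
  have m: "m \<noteq> 0" using A by (simp add: m_def)
  have d: "d i \<noteq> 0" if "i \<in> A" for i using deg[OF that] m by (auto simp: m_def)
  define F where "F B = (\<Prod>u\<in>B. [:\<nu> u, 1:])" for B
  define Q where "Q = (\<Sum>i\<in>A. smult (1 / m) (F (A - {i})))"
  have factor: "F A = F (A - {i}) * [:\<nu> i, 1:]" if "i \<in> A" for i
    using that A(1) by (simp add: F_def prod.remove mult.commute)
  have Y: "shift_op [:\<nu> i, 1:] (Y i) = (\<lambda>k. (1 / d i) * S k)" if "i \<in> A" for i
    using step[OF that] d[OF that] by (simp add: shift_op_linear_factor fun_eq_iff S_def field_simps)
  have secular: "F A = (\<Sum>i\<in>A. smult (1 / d i) (F (A - {i}))) + [:-1, 1:] * Q"
  proof -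
    have "F A = (\<Sum>i\<in>A. smult (1 / m) (F A))" using m by (simp add: m_def of_nat_poly)
    also have "\<dots> = (\<Sum>i\<in>A. smult (1 / d i) (F (A - {i})) + [:-1, 1:] * smult (1 / m) (F (A - {i})))"
    proof (rule sum.cong)
      fix i assume i: "i \<in> A"
      have "[:\<nu> i, 1:] = smult (m / d i) 1 + [:-1, 1:]"
        using deg[OF i] d[OF i] by (simp add: m_def one_pCons field_simps)
      then have "smult (1 / m) (F A) = smult (1 / m) (F (A - {i}) * (smult (m / d i) 1 + [:-1, 1:]))"
        by (simp only: factor[OF i])
      also have "\<dots> = smult (1 / d i) (F (A - {i})) + [:-1, 1:] * smult (1 / m) (F (A - {i}))"
        using m by (simp only: distrib_left smult_add_right mult_smult_right mult_smult_left smult_smult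
            mult_1_right mult.commute[of _ "[:-1, 1:]"]) simp
      finally show "smult (1 / m) (F A) = smult (1 / d i) (F (A - {i})) + [:-1, 1:] * smult (1 / m) (F (A - {i}))" .
    qed simp
    finally show ?thesis by (simp add: sum.distrib Q_def sum_distrib_left)
  qed
  have "shift_op (F A) S k = shift_op (\<Sum>i\<in>A. smult (1 / d i) (F (A - {i}))) S k" for k
  proof -
    have "shift_op (F A) S k = (\<Sum>i\<in>A. shift_op (F A) (Y i) k)"
      by (simp add: S_def[abs_def] shift_op_sum)
    also have "\<dots> = (\<Sum>i\<in>A. shift_op (F (A - {i})) (shift_op [:\<nu> i, 1:] (Y i)) k)"
      by (rule sum.cong) (simp_all only: factor shift_op_mult)
    also have "\<dots> = (\<Sum>i\<in>A. (1 / d i) * shift_op (F (A - {i})) S k)"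
      by (rule sum.cong) (simp_all only: Y shift_op_scale)
    finally show ?thesis by (simp add: shift_op_sum_poly shift_op_smult)
  qed
  then have "shift_op ([:-1, 1:] * Q) S k = 0" for k
    by (simp add: secular shift_op_add)
  then have "shift_op Q S (Suc k) = shift_op Q S k" for k
    by (simp only: shift_op_mult shift_op_linear_factor) (simp add: algebra_simps)
  then have const: "shift_op Q S k = shift_op Q S 0" for k by (induction k) auto
  have "S \<longlonglongrightarrow> (\<Sum>j\<in>A. 0)" unfolding S_def[abs_def] by (intro tendsto_sum lim)
  then have "shift_op Q S \<longlonglongrightarrow> 0" by (intro shift_op_tendsto_0) simp
  then have "(\<lambda>k. shift_op Q S 0) \<longlonglongrightarrow> 0" 
    by (rule Lim_transform_eventually) (use const in auto)
  then have "shift_op Q S 0 = 0" by (simp add: LIMSEQ_const_iff)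
  then have QS: "shift_op Q S k = 0" for k by (simp add: const[of k])
  have "cluster_poly A \<nu> = F (A - {i}) * (Q * [:\<nu> i, 1:])"
    unfolding cluster_poly_def F_def[symmetric] factor[OF i] m_def[symmetric] Q_def[symmetric]
    by (simp only: ac_simps)
  moreover have "shift_op (Q * [:\<nu> i, 1:]) (Y i) = (\<lambda>k. 0)"
    by (simp only: shift_op_mult Y[OF i] shift_op_scale fun_eq_iff QS) simp
  ultimately show ?thesis by (simp only: shift_op_mult) (simp add: shift_op_def)
qed

section \<open>Linear dynamics on complete multipartite clusters\<close>

definition cluster_graph :: "('n \<Rightarrow> 'c) \<Rightarrow> ('n \<Rightarrow> 'd) \<Rightarrow> ('n \<times> 'n) set" where
  "cluster_graph col clus = {(i, j). i = j \<or> clus i = clus j \<and> col i \<noteq> col j}"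

lemma refl_cluster_graph: "refl (cluster_graph col clus)"
  by (simp add: cluster_graph_def refl_on_def)

lemma sym_cluster_graph: "sym (cluster_graph col clus)"
  by (auto simp: cluster_graph_def sym_def)

lemma linear_local_mean: "linear (local_mean G)"
  by (rule linearI) (simp_all add: local_mean_def vec_eq_iff sum.distrib sum_distrib_left
      sum_divide_distrib algebra_simps)

text \<open>
  The pair \<open>(i', j')\<close> may differ from \<open>(i, j)\<close>: by time \<open>K\<close> only the supremum over all pairs of the
  two clusters is attained, not the supremum of each single gap.
\<close>

definition gap_horizon :: "('n::finite \<Rightarrow> 'c) \<Rightarrow> ('n \<Rightarrow> 'd) \<Rightarrow> nat \<Rightarrow> bool" where
  "gap_horizon col clus K \<longleftrightarrow> (\<forall>x i j k. clus i \<noteq> clus j \<and> col i \<noteq> col j \<longrightarrow>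
    (\<exists>k'\<le>K. \<exists>i' j'. clus i' = clus i \<and> clus j' = clus j \<and> col i' \<noteq> col j' \<and>
      (local_mean (cluster_graph col clus) ^^ k) x $ i - (local_mean (cluster_graph col clus) ^^ k) x $ j
      \<le> (local_mean (cluster_graph col clus) ^^ k') x $ i' - (local_mean (cluster_graph col clus) ^^ k') x $ j'))"


text \<open>
  The colour \<open>col i\<close> names the part of agent \<open>i\<close>. The assumption says that a cluster with at least two
  agents meets at least two parts, which makes it connected in the cluster graph.
\<close>

locale clusters =
  fixes col :: "'n::finite \<Rightarrow> 'c" and clus :: "'n \<Rightarrow> 'd"
  assumes linked: "clus i = clus j \<Longrightarrow> col i = col j \<Longrightarrow> i \<noteq> j \<Longrightarrow> \<exists>k. clus k = clus i \<and> col k \<noteq> col i"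
begin

abbreviation "G \<equiv> cluster_graph col clus"

definition traj :: "real ^ 'n \<Rightarrow> nat \<Rightarrow> 'n \<Rightarrow> real" where
  "traj x k i = (local_mean G ^^ k) x $ i"

definition members :: "'n \<Rightarrow> 'n set" where
  "members i = {j. clus j = clus i}"

definition block :: "'n \<Rightarrow> 'n set" where
  "block i = {j. clus j = clus i \<and> col j = col i}"

definition deg :: "'n \<Rightarrow> real" where
  "deg i = real (card (G `` {i}))"

lemma neighbours_eq: "G `` {i} = insert i (members i - block i)"
  by (auto simp: cluster_graph_def members_def block_def)

lemma block_subset: "block i \<subseteq> members i"
  by (auto simp: members_def block_def)

lemma self_in_block: "i \<in> block i"
  by (simp add: block_def)

lemma block_card_pos: "0 < card (block i)"
  using self_in_block by (auto simp: card_gt_0_iff)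

lemma block_nonempty [simp]: "block i \<noteq> {}"
  using self_in_block by blast

lemma block_cong: "j \<in> block i \<Longrightarrow> block j = block i"
  by (auto simp: block_def)

lemma members_cong: "j \<in> members i \<Longrightarrow> members j = members i"
  by (auto simp: members_def)

lemma deg_eq: "deg i = real (card (members i)) - real (card (block i)) + 1"
proof -
  have "i \<notin> members i - block i" by (simp add: self_in_block)
  then have "card (G `` {i}) = Suc (card (members i - block i))" by (simp add: neighbours_eq)
  moreover have "card (members i - block i) = card (members i) - card (block i)"
    by (rule card_Diff_subset) (use block_subset in auto)
  moreover have "card (block i) \<le> card (members i)" by (rule card_mono) (use block_subset in auto)
  ultimately show ?thesis by (simp add: deg_def)
qed

lemma deg_pos: "0 < deg i"
  using degree_pos[OF refl_cluster_graph] by (simp add: deg_def)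

lemma deg_block_cong: "j \<in> block i \<Longrightarrow> deg j = deg i"
  using block_cong[of j i] members_cong[of j i] block_subset[of i] by (auto simp: deg_eq)

lemma deg_times_traj_Suc:
  "deg i * traj x (Suc k) i = (\<Sum>j\<in>G `` {i}. traj x k j)"
  using deg_pos[of i] by (simp add: traj_def local_mean_def deg_def)

lemma neighbour_sum: "(\<Sum>j\<in>G `` {i}. f j) = f i + (\<Sum>j\<in>members i. f j) - (\<Sum>j\<in>block i. f j)"
  for f :: "'n \<Rightarrow> real"
proof -
  have "(\<Sum>j\<in>G `` {i}. f j) = f i + (\<Sum>j\<in>members i - block i. f j)"
    unfolding neighbours_eq by (rule sum.insert) (auto simp: self_in_block)
  also have "(\<Sum>j\<in>members i - block i. f j) = (\<Sum>j\<in>members i. f j) - (\<Sum>j\<in>block i. f j)"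
    by (rule sum_diff) (use block_subset in auto)
  finally show ?thesis by simp
qed

lemma linear_traj: "linear (\<lambda>x. traj x k i)"
proof -
  have "linear (local_mean G ^^ k)"
  proof (induction k)
    case 0
    show ?case by (simp add: linear_id id_def[symmetric])
  next
    case (Suc k)
    show ?case using linear_compose[OF Suc linear_local_mean[of G]] by (simp add: o_def)
  qed
  then show ?thesis unfolding traj_def
    by (intro linearI) (simp_all add: linear_add linear_cmul)
qed

text \<open>
  The common limit of the agents in the cluster of \<open>i\<close>.
\<close>

definition centre :: "'n \<Rightarrow> real ^ 'n \<Rightarrow> real" where
  "centre i x = (\<Sum>j\<in>members i. deg j * x $ j) / (\<Sum>j\<in>members i. deg j)"

lemma linear_centre: "linear (centre i)"
  unfolding centre_def
  by (rule linearI) (simp_all add: algebra_simps sum.distrib sum_distrib_left add_divide_distrib)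

lemma centre_cong: "clus i = clus j \<Longrightarrow> centre i = centre j"
  by (simp add: centre_def members_def fun_eq_iff)

text \<open>
  The degree-weighted sum is invariant because the adjacency relation is symmetric.
\<close>

lemma centre_conserved: "(\<Sum>j\<in>members i. deg j * traj x k j) = (\<Sum>j\<in>members i. deg j * x $ j)"
proof (induction k)
  case 0
  show ?case by (simp add: traj_def)
next
  case (Suc k)
  let ?H = "Sigma (members i) (\<lambda>j. G `` {j})"
  have "sym ?H"
    by (auto simp: sym_def members_def cluster_graph_def)
  have "(\<Sum>j\<in>members i. deg j * traj x (Suc k) j) = (\<Sum>j\<in>members i. \<Sum>l\<in>G `` {j}. traj x k l)"
    by (simp only: deg_times_traj_Suc)
  also have "\<dots> = (\<Sum>(j, l)\<in>?H. traj x k l)" by (rule sum.Sigma) auto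
  also have "\<dots> = (\<Sum>(j, l)\<in>?H. traj x k j)" by (rule sum_edges_swap[OF \<open>sym ?H\<close>])
  also have "\<dots> = (\<Sum>j\<in>members i. \<Sum>l\<in>G `` {j}. traj x k j)" by (rule sum.Sigma[symmetric]) auto
  also have "\<dots> = (\<Sum>j\<in>members i. deg j * traj x k j)" by (simp add: deg_def)
  finally show ?case using Suc by simp
qed

lemma cluster_difference_tendsto_0:
  assumes "clus i = clus j"
  shows "(\<lambda>k. traj x k i - traj x k j) \<longlonglongrightarrow> 0"
proof (cases "(i, j) \<in> G")
  case True
  then show ?thesis unfolding traj_def
    by (intro edge_difference_tendsto_0 sym_cluster_graph refl_cluster_graph)
next
  case False
  then have "col i = col j" "i \<noteq> j" using assms by (auto simp: cluster_graph_def)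
  then obtain l where "clus l = clus i" "col l \<noteq> col i" using linked assms by blast
  then have "(i, l) \<in> G" "(l, j) \<in> G" using assms \<open>col i = col j\<close> by (auto simp: cluster_graph_def)
  then have "(\<lambda>k. (traj x k i - traj x k l) + (traj x k l - traj x k j)) \<longlonglongrightarrow> 0 + 0"
    unfolding traj_def
    by (intro tendsto_add edge_difference_tendsto_0 sym_cluster_graph refl_cluster_graph)
  then show ?thesis by simp
qed

lemma traj_tendsto_centre: "(\<lambda>k. traj x k i - centre i x) \<longlonglongrightarrow> 0"
proof -
  define w where "w = (\<Sum>j\<in>members i. deg j)"
  have "i \<in> members i" by (simp add: members_def)
  then have w: "0 < w" unfolding w_def by (intro sum_pos deg_pos) auto
  have "traj x k i - centre i x = (\<Sum>j\<in>members i. deg j * (traj x k i - traj x k j)) / w" for k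
    using w by (simp add: centre_def w_def[symmetric] centre_conserved[where i = i and x = x and k = k, symmetric]
        right_diff_distrib sum_subtractf sum_distrib_right[symmetric] diff_divide_distrib)
  moreover have "(\<lambda>k. (\<Sum>j\<in>members i. deg j * (traj x k i - traj x k j)) / w)
      \<longlonglongrightarrow> (\<Sum>j\<in>members i. deg j * 0) / w"
    using w by (intro tendsto_divide tendsto_sum tendsto_mult tendsto_const cluster_difference_tendsto_0)
      (auto simp: members_def)
  ultimately show ?thesis by simp
qed

definition block_dev :: "real ^ 'n \<Rightarrow> 'n \<Rightarrow> nat \<Rightarrow> real" where
  "block_dev x i k = (\<Sum>j\<in>block i. traj x k j - centre i x) / real (card (block i))"

text \<open>
  Summing block averages over agents counts each block as often as it has members, which undoes the
  averaging.
\<close>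

lemma sum_block_dev:
  "(\<Sum>j\<in>members i. block_dev x j k) = (\<Sum>j\<in>members i. traj x k j - centre i x)"
proof -
  define f where "f j = traj x k j - centre i x" for j
  have "(\<Sum>j\<in>members i. block_dev x j k)
      = (\<Sum>j\<in>members i. \<Sum>l\<in>members i. if col l = col j then f l / real (card (block l)) else 0)"
  proof (rule sum.cong)
    fix j assume j: "j \<in> members i"
    have "block j = members i \<inter> {l. col l = col j}"
      using j by (auto simp: block_def members_def)
    moreover have "block_dev x j k = (\<Sum>l\<in>block j. f l / real (card (block l)))"
      using centre_cong[of j i] j block_cong[of _ j]
      by (auto simp: block_dev_def f_def sum_divide_distrib members_def intro!: sum.cong)
    ultimately show "block_dev x j k
        = (\<Sum>l\<in>members i. if col l = col j then f l / real (card (block l)) else 0)"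
      by (simp add: sum.inter_restrict)
  qed simp
  also have "\<dots> = (\<Sum>l\<in>members i. \<Sum>j\<in>members i. if col l = col j then f l / real (card (block l)) else 0)"
    by (rule sum.swap)
  also have "\<dots> = (\<Sum>l\<in>members i. f l)"
  proof (rule sum.cong)
    fix l assume l: "l \<in> members i"
    have "block l = members i \<inter> {j. col l = col j}"
      using l by (auto simp: block_def members_def)
    then have "(\<Sum>j\<in>members i. if col l = col j then c else 0) = (\<Sum>j\<in>block l. c)" for c :: real
      by (simp only: sum.inter_restrict[OF finite] mem_Collect_eq)
    then show "(\<Sum>j\<in>members i. if col l = col j then f l / real (card (block l)) else 0) = f l"
      by simp
  qed simp
  finally show ?thesis by (simp add: f_def)
qed

text \<open>
  The own part of \<open>i\<close> is missing from its neighbourhood, except for \<open>i\<close> itself. Averaged over the part,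
  this makes the part's old average enter the new one with the weight \<open>- lag i \<le> 0\<close>.
\<close>

definition lag :: "'n \<Rightarrow> real" where
  "lag i = (real (card (block i)) - 1) / deg i"

lemma lag_nonneg: "0 \<le> lag i"
  using block_card_pos[of i] deg_pos[of i] by (simp add: lag_def)

lemma block_dev_step:
  "deg i * (block_dev x i (Suc k) + lag i * block_dev x i k) = (\<Sum>j\<in>members i. block_dev x j k)"
proof -
  define c where "c = centre i x"
  define n where "n = real (card (block i))"
  define S where "S = (\<Sum>j\<in>members i. traj x k j - c)"
  have n: "n \<noteq> 0" by (simp add: n_def)
  have B: "(\<Sum>j\<in>block i. traj x k j - c) = n * block_dev x i k"
    using n by (simp add: block_dev_def n_def c_def)
  have "deg i * (\<Sum>j\<in>block i. traj x (Suc k) j - c)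
      = (\<Sum>j\<in>block i. (traj x k j - c) + S - n * block_dev x i k)"
    unfolding sum_distrib_left
  proof (rule sum.cong)
    fix j assume j: "j \<in> block i"
    have "deg i * (traj x (Suc k) j - c) = deg j * traj x (Suc k) j - deg j * c"
      by (simp add: deg_block_cong[OF j] right_diff_distrib)
    also have "\<dots> = (\<Sum>l\<in>G `` {j}. traj x k l - c)"
      by (simp only: deg_times_traj_Suc) (simp add: sum_subtractf deg_def)
    also have "\<dots> = (traj x k j - c) + S - n * block_dev x i k"
      using j block_subset[of i]
      by (subst neighbour_sum) (auto simp: block_cong[OF j] members_cong[of j i] S_def B)
    finally show "deg i * (traj x (Suc k) j - c) = (traj x k j - c) + S - n * block_dev x i k" .
  qed simp
  also have "\<dots> = n * (block_dev x i k + S - n * block_dev x i k)"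
    using B by (simp add: sum_subtractf sum.distrib n_def[symmetric] algebra_simps)
  finally have "deg i * (n * block_dev x i (Suc k)) = n * (block_dev x i k + S - n * block_dev x i k)"
    using n by (simp add: block_dev_def n_def c_def)
  then have "deg i * block_dev x i (Suc k) = block_dev x i k + S - n * block_dev x i k"
    using n by simp
  moreover have "deg i * lag i = n - 1" using deg_pos[of i] by (simp add: lag_def n_def)
  then have "deg i * (lag i * block_dev x i k) = (n - 1) * block_dev x i k"
    by (simp add: mult.assoc[symmetric])
  ultimately show ?thesis
    unfolding sum_block_dev S_def c_def by (simp add: algebra_simps)
qed

lemma block_dev_annihilated:
  assumes "clus i = clus a"
  shows "shift_op (cluster_poly (members a) lag) (block_dev x i) k = 0"
proof (rule cluster_poly_annihilates[where Y = "block_dev x" and d = deg])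
  show "finite (members a)" "members a \<noteq> {}" by (auto simp: members_def)
  show "i \<in> members a" using assms by (simp add: members_def)
  fix j assume j: "j \<in> members a"
  then have m: "members j = members a" by (rule members_cong)
  show "deg j * (1 + lag j) = real (card (members a))"
    using deg_pos[of j] by (simp add: lag_def distrib_left) (simp add: deg_eq m)
  show "deg j * (block_dev x j (Suc k) + lag j * block_dev x j k) = (\<Sum>j\<in>members a. block_dev x j k)" for k
    by (simp add: block_dev_step m)
  have "(\<lambda>k. (\<Sum>l\<in>block j. traj x k l - centre j x) / real (card (block j)))
      \<longlonglongrightarrow> (\<Sum>l\<in>block j. 0) / real (card (block j))"
  proof (intro tendsto_divide tendsto_sum tendsto_const)
    fix l assume "l \<in> block j"
    then have "centre j = centre l" by (intro centre_cong) (simp add: block_def)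
    then show "(\<lambda>k. traj x k l - centre j x) \<longlonglongrightarrow> 0" by (simp only: traj_tendsto_centre)
  qed simp
  then show "block_dev x j \<longlonglongrightarrow> 0" by (simp add: block_dev_def[abs_def])
qed

text \<open>
  The gaps are compared with their limit, the difference of the two centres. If they never exceed
  the limit from time \<open>m\<close> on, then neither do the gaps between part averages. These satisfy a
  recurrence with nonnegative coefficients, so they equal the limit. But an average of nonpositive
  numbers that is zero forces every single one of them to be zero. Averaging is essential: the
  deviations inside a part decay with positive eigenvalues and satisfy no such recurrence.
\<close>

lemma pair_gap_attained:
  assumes ab: "clus a \<noteq> clus b"
  shows "\<exists>K. \<forall>x i j k. clus i = clus a \<and> clus j = clus b \<and> col i \<noteq> col j \<longrightarrow>
    (\<exists>k'\<le>K. \<exists>i' j'. clus i' = clus a \<and> clus j' = clus b \<and> col i' \<noteq> col j' \<and>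
      traj x k i - traj x k j \<le> traj x k' i' - traj x k' j')"
proof -
  define P where "P = cluster_poly (members a) lag * cluster_poly (members b) lag"
  define m where "m = (LEAST i. coeff P i \<noteq> 0)"
  define L where "L = {(i, j). clus i = clus a \<and> clus j = clus b \<and> col i \<noteq> col j}"
  \<comment> \<open>The time is shifted by \<open>m\<close>, the lowest exponent in \<open>P\<close>: a factor \<open>t\<close> of \<open>P\<close>, from an
    eigenvalue \<open>0\<close>, leaves the first states unconstrained.\<close>
  define h where "h l k x = (traj x (k + m) (fst l) - centre a x) - (traj x (k + m) (snd l) - centre b x)"
    for l k x
  have "nonneg_poly P"
    unfolding P_def by (intro nonneg_poly_mult nonneg_cluster_poly) (auto simp: members_def lag_nonneg)
  have "\<exists>K. \<forall>x. \<forall>l\<in>L. \<forall>k. \<exists>l'\<in>L. \<exists>k'\<le>K. h l k x \<le> h l' k' x"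
  proof (rule vanishing_functionals_sup_attained)
    show "finite L" by simp
    show "linear (h l k)" for l k
      unfolding h_def by (intro linear_compose_sub linear_traj linear_centre)
    show "(\<lambda>k. h l k x) \<longlonglongrightarrow> 0" if "l \<in> L" for l x
    proof -
      have "centre a = centre (fst l)" "centre b = centre (snd l)"
        using that by (auto simp: L_def intro: centre_cong)
      then have "(\<lambda>k. h l k x) \<longlonglongrightarrow> 0 - 0"
        unfolding h_def
        by (simp only:) (intro tendsto_diff LIMSEQ_ignore_initial_segment traj_tendsto_centre)
      then show ?thesis by simp
    qed
    fix x l k
    assume le: "\<And>l k. l \<in> L \<Longrightarrow> h l k x \<le> 0" and l: "l \<in> L"
    obtain i j where ij: "l = (i, j)" "clus i = clus a" "clus j = clus b" "col i \<noteq> col j"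
      using l by (auto simp: L_def)
    define F where "F k = block_dev x i k - block_dev x j k" for k
    have rect: "block i \<times> block j \<subseteq> L" using ij by (auto simp: block_def L_def)
    have F: "real (card (block i)) * real (card (block j)) * F (k + m)
        = (\<Sum>q\<in>block i \<times> block j. h q k x)" for k
    proof -
      have "(\<Sum>q\<in>block i \<times> block j. h q k x)
          = (\<Sum>i'\<in>block i. \<Sum>j'\<in>block j. (traj x (k + m) i' - centre a x) - (traj x (k + m) j' - centre b x))"
        unfolding h_def by (simp add: sum.cartesian_product case_prod_unfold)
      also have "\<dots> = real (card (block j)) * (\<Sum>i'\<in>block i. traj x (k + m) i' - centre a x)
          - real (card (block i)) * (\<Sum>j'\<in>block j. traj x (k + m) j' - centre b x)"
        by (simp only: sum_subtractf sum_constant) (simp add: sum_distrib_left sum_subtractf algebra_simps)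
      also have "\<dots> = real (card (block i)) * real (card (block j)) * F (k + m)"
        using block_card_pos[of i] block_card_pos[of j] centre_cong[OF ij(2)] centre_cong[OF ij(3)]
        by (simp add: F_def block_dev_def field_simps)
      finally show ?thesis by simp
    qed
    have F0: "F (k + m) = 0"
    proof (rule nonpos_recurrent_imp_0[OF \<open>nonneg_poly P\<close> m_def])
      show "shift_op P F k = 0" for k
      proof -
        have "shift_op (cluster_poly (members a) lag) (block_dev x i) = (\<lambda>k. 0)"
          "shift_op (cluster_poly (members b) lag) (block_dev x j) = (\<lambda>k. 0)"
          using block_dev_annihilated ij(2,3) by blast+
        then have "shift_op P (block_dev x i) k = 0" "shift_op P (block_dev x j) k = 0"
          unfolding P_def by (metis mult.commute shift_op_mult_eq_0)+
        then show ?thesis by (simp add: F_def[abs_def] shift_op_diff)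
      qed
      show "F k \<le> 0" if "m \<le> k" for k
      proof -
        have "(\<Sum>q\<in>block i \<times> block j. h q (k - m) x) \<le> 0"
          by (rule sum_nonpos) (use rect le in blast)
        with F[of "k - m"] that have "real (card (block i)) * real (card (block j)) * F k \<le> 0" by simp
        moreover have "0 < real (card (block i)) * real (card (block j))"
          using block_card_pos by simp
        ultimately show ?thesis by (metis mult_pos_pos not_less)
      qed
    qed simp
    have "(\<Sum>q\<in>block i \<times> block j. - h q k x) = 0" using F[of k] F0 by (simp add: sum_negf)
    then have "\<forall>q\<in>block i \<times> block j. - h q k x = 0"
      by (subst (asm) sum_nonneg_eq_0_iff) (use rect le in auto)
    then show "h l k x = 0" using self_in_block by (auto simp: ij(1))
  qed
  then obtain K where K: "\<And>x l k. l \<in> L \<Longrightarrow> \<exists>l'\<in>L. \<exists>k'\<le>K. h l k x \<le> h l' k' x" by blast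
  show ?thesis
  proof (rule exI[of _ "K + m"], intro allI impI)
    fix x i j k assume ij: "clus i = clus a \<and> clus j = clus b \<and> col i \<noteq> col j"
    show "\<exists>k'\<le>K + m. \<exists>i' j'. clus i' = clus a \<and> clus j' = clus b \<and> col i' \<noteq> col j' \<and>
      traj x k i - traj x k j \<le> traj x k' i' - traj x k' j'"
    proof (cases "m \<le> k")
      case True
      have "(i, j) \<in> L" using ij by (simp add: L_def)
      from K[OF this, of "k - m" x] obtain i' j' k' where
        "(i', j') \<in> L" "k' \<le> K" "h (i, j) (k - m) x \<le> h (i', j') k' x" by auto
      then show ?thesis using True
        by (intro exI[of _ "k' + m"] conjI exI[of _ i'] exI[of _ j']) (auto simp: h_def L_def)
    next
      case False
      then show ?thesis using ij by (intro exI[of _ k] conjI exI[of _ i] exI[of _ j]) auto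
    qed
  qed
qed

end

lemma (in clusters) ex_gap_horizon: "\<exists>K. gap_horizon col clus K"
proof -
  define good where "good a b K \<longleftrightarrow> (\<forall>x i j k. clus i = clus a \<and> clus j = clus b \<and> col i \<noteq> col j \<longrightarrow>
    (\<exists>k'\<le>K. \<exists>i' j'. clus i' = clus a \<and> clus j' = clus b \<and> col i' \<noteq> col j' \<and>
      traj x k i - traj x k j \<le> traj x k' i' - traj x k' j'))" for a b K
  have "\<forall>q. \<exists>K. clus (fst q) \<noteq> clus (snd q) \<longrightarrow> good (fst q) (snd q) K"
    using pair_gap_attained unfolding good_def by blast
  then obtain K where K: "\<And>a b. clus a \<noteq> clus b \<Longrightarrow> good a b (K (a, b))"
    by (metis fst_conv snd_conv)
  have le: "K q \<le> Max (range K)" for q by (rule Max_ge) auto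
  show ?thesis
    unfolding gap_horizon_def traj_def[symmetric]
  proof (rule exI[of _ "Max (range K)"], intro allI impI)
    fix x i j k assume ij: "clus i \<noteq> clus j \<and> col i \<noteq> col j"
    then have "good i j (K (i, j))" using K by blast
    then obtain k' i' j' where "k' \<le> K (i, j)" "clus i' = clus i" "clus j' = clus j" "col i' \<noteq> col j'"
      "traj x k i - traj x k j \<le> traj x k' i' - traj x k' j'"
      unfolding good_def using ij by blast
    then show "\<exists>k'\<le>Max (range K). \<exists>i' j'. clus i' = clus i \<and> clus j' = clus j \<and> col i' \<noteq> col j' \<and>
      traj x k i - traj x k j \<le> traj x k' i' - traj x k' j'"
      using le[of "(i, j)"] order_trans by blast
  qed
qed

text \<open>
  Labelling clusters by sets of agents leaves finitely many labellings, so one horizon serves all.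
\<close>

lemma ex_uniform_gap_horizon:
  "\<exists>K. \<forall>clus :: 'n \<Rightarrow> 'n set. clusters col clus \<longrightarrow> gap_horizon col clus K"
  for col :: "'n::finite \<Rightarrow> 'c"
proof -
  have "\<forall>clus :: 'n \<Rightarrow> 'n set. \<exists>K. clusters col clus \<longrightarrow> gap_horizon col clus K"
    using clusters.ex_gap_horizon by blast
  then obtain K where K: "\<And>clus :: 'n \<Rightarrow> 'n set. clusters col clus \<Longrightarrow> gap_horizon col clus (K clus)" by metis
  have le: "K clus \<le> Max (range K)" for clus by (rule Max_ge) auto
  have "gap_horizon col clus k \<Longrightarrow> k \<le> l \<Longrightarrow> gap_horizon col clus l" for clus :: "'n \<Rightarrow> 'n set" and k l
    unfolding gap_horizon_def by (meson order_trans)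
  then show ?thesis using K le by blast
qed


section \<open>Tight clusters in the influence graph\<close>

definition partite_graph :: "('n \<Rightarrow> 'c) \<Rightarrow> ('n \<times> 'n) set" where
  "partite_graph col = {(i, j). i = j \<or> col i \<noteq> col j}"

lemma influence_iff:
  "0 < R \<Longrightarrow> (i, j) \<in> influence_graph R (partite_graph col) x \<longleftrightarrow>
    i = j \<or> col i \<noteq> col j \<and> \<bar>x $ i - x $ j\<bar> \<le> R"
  by (auto simp: influence_graph_def partite_graph_def)

lemma sym_influence: "0 < R \<Longrightarrow> sym (influence_graph R (partite_graph col) x)"
  by (auto simp: sym_def influence_iff abs_minus_commute)

lemma refl_influence: "0 < R \<Longrightarrow> refl (influence_graph R (partite_graph col) x)"
  by (simp add: refl_on_def influence_iff)

text \<open>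
  A path of at most three short edges has length at most \<open>R\<close>, so its ends are linked unless they lie
  in one part. Hence connected agents are linked or have a common neighbour, and the clusters are the
  connected components.
\<close>

lemma short_edges_imp_clusters:
  fixes col :: "'n::finite \<Rightarrow> 'c" and x :: "real ^ 'n"
  assumes "0 < R" "3 * \<eta> \<le> R" "0 \<le> \<eta>"
    and short: "\<And>i j. (i, j) \<in> influence_graph R (partite_graph col) x \<Longrightarrow> \<bar>x $ i - x $ j\<bar> \<le> \<eta>"
  obtains clus :: "'n \<Rightarrow> 'n set" where "clusters col clus"
    "influence_graph R (partite_graph col) x = cluster_graph col clus"
    "\<And>i j. clus i = clus j \<Longrightarrow> \<bar>x $ i - x $ j\<bar> \<le> 2 * \<eta>"
proof -
  define \<Gamma> where "\<Gamma> = influence_graph R (partite_graph col) x"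
  have mem: "(i, j) \<in> \<Gamma> \<longleftrightarrow> i = j \<or> col i \<noteq> col j \<and> \<bar>x $ i - x $ j\<bar> \<le> R" for i j
    using influence_iff[OF assms(1)] by (simp add: \<Gamma>_def)
  have symG: "sym \<Gamma>" using sym_influence[OF assms(1)] by (simp add: \<Gamma>_def)
  have short: "\<bar>x $ i - x $ j\<bar> \<le> \<eta>" if "(i, j) \<in> \<Gamma>" for i j using short that by (simp add: \<Gamma>_def)
  have near: "(i, j) \<in> \<Gamma> \<or> col i = col j \<and> (\<exists>k. (i, k) \<in> \<Gamma> \<and> (k, j) \<in> \<Gamma>)" if "(i, j) \<in> \<Gamma>\<^sup>*" for i j
    using that
  proof (induction rule: rtrancl_induct)
    case base
    show ?case by (simp add: mem)
  next
    case (step j l)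
    show ?case
    proof (cases "(i, j) \<in> \<Gamma>")
      case True
      then show ?thesis using step(2) short[OF True] short[OF step(2)] assms(2,3)
        by (cases "col i = col l") (auto simp: mem)
    next
      case False
      with step.IH obtain k where k: "col i = col j" "(i, k) \<in> \<Gamma>" "(k, j) \<in> \<Gamma>" by blast
      show ?thesis
      proof (cases "col i = col l")
        case True
        then have "l = j" using step(2) k(1) by (auto simp: mem)
        then show ?thesis using k by blast
      next
        case False
        have "\<bar>x $ i - x $ l\<bar> \<le> R"
          using short[OF k(2)] short[OF k(3)] short[OF step(2)] assms(2) by linarith
        then show ?thesis using False by (simp add: mem)
      qed
    qed
  qed
  define clus where "clus i = \<Gamma>\<^sup>* `` {i}" for i
  have clus: "clus i = clus j \<longleftrightarrow> (i, j) \<in> \<Gamma>\<^sup>*" for i j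
  proof
    assume "clus i = clus j"
    moreover have "j \<in> clus j" by (simp add: clus_def)
    ultimately have "j \<in> clus i" by simp
    then show "(i, j) \<in> \<Gamma>\<^sup>*" by (simp add: clus_def)
  next
    assume "(i, j) \<in> \<Gamma>\<^sup>*"
    moreover from this have "(j, i) \<in> \<Gamma>\<^sup>*" using symG sym_rtrancl by (meson symD)
    ultimately show "clus i = clus j" unfolding clus_def by (auto intro: rtrancl_trans)
  qed
  show thesis
  proof
    show "clusters col clus"
    proof
      fix i j assume "clus i = clus j" "col i = col j" "i \<noteq> j"
      then obtain k where "(i, k) \<in> \<Gamma>" "(k, j) \<in> \<Gamma>" using near[of i j] by (auto simp: clus mem)
      moreover from this have "k \<noteq> i" using \<open>col i = col j\<close> \<open>i \<noteq> j\<close> by (auto simp: mem)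
      ultimately have "clus k = clus i \<and> col k \<noteq> col i"
        using clus[of i k] by (auto simp: mem)
      then show "\<exists>k. clus k = clus i \<and> col k \<noteq> col i" by blast
    qed
    show "influence_graph R (partite_graph col) x = cluster_graph col clus"
    proof -
      have "(i, j) \<in> \<Gamma> \<longleftrightarrow> (i, j) \<in> cluster_graph col clus" for i j
        using near[of i j] mem[of i j] clus[of i j] unfolding cluster_graph_def by blast
      then show ?thesis unfolding \<Gamma>_def[symmetric] by auto
    qed
    show "\<bar>x $ i - x $ j\<bar> \<le> 2 * \<eta>" if same: "clus i = clus j" for i j
    proof -
      consider "(i, j) \<in> \<Gamma>" | k where "(i, k) \<in> \<Gamma>" "(k, j) \<in> \<Gamma>"
        using same near[of i j] by (auto simp: clus)
      then show ?thesis
      proof cases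
        case 1
        then show ?thesis using short[OF 1] assms(3) by linarith
      next
        case 2
        show ?thesis using short[OF 2(1)] short[OF 2(2)] by linarith
      qed
    qed
  qed
qed

text \<open>
  Each step averages inside a cluster, so an interval that contains the cluster at one time contains
  it ever after. The statement applies this to the interval of radius \<open>D\<close> around each initial position in the cluster.
\<close>

lemma cluster_hull_invariant:
  fixes col :: "'n::finite \<Rightarrow> 'c"
  assumes "\<And>i j. clus i = clus j \<Longrightarrow> \<bar>x $ i - x $ j\<bar> \<le> D" "clus i = clus j"
  shows "\<bar>(local_mean (cluster_graph col clus) ^^ k) x $ i - x $ j\<bar> \<le> D"
  using assms(2)
proof (induction k arbitrary: i)
  case 0
  then show ?case using assms(1) by simp
next
  case (Suc k)
  define y where "y = (local_mean (cluster_graph col clus) ^^ k) x"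
  have nbr: "x $ j - D \<le> y $ l \<and> y $ l \<le> x $ j + D" if "(i, l) \<in> cluster_graph col clus" for l
  proof -
    have "clus l = clus j" using that Suc.prems by (auto simp: cluster_graph_def)
    from Suc.IH[OF this] show ?thesis unfolding y_def by linarith
  qed
  have "x $ j - D \<le> local_mean (cluster_graph col clus) y $ i"
    "local_mean (cluster_graph col clus) y $ i \<le> x $ j + D"
    using nbr by (intro local_mean_between refl_cluster_graph; blast)+
  then show ?case by (simp add: y_def[symmetric] abs_le_iff)
qed

text \<open>
  Inside a cluster the hull keeps all links. If agents \<open>i\<close> and \<open>j\<close> of different clusters met at a late
  time, then by the gap horizon two agents of the same clusters would already have been at a signed
  gap at least as favourable by time \<open>K\<close>. At that time the clusters are separated by more than \<open>R\<close>, so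
  they would have exchanged their order, which is impossible as every agent stays within \<open>D\<close> of its
  initial position.
\<close>

lemma static_forever:
  fixes col :: "'n::finite \<Rightarrow> 'c" and x :: "real ^ 'n"
  assumes "0 < R" "4 * D < R" "0 \<le> D"
    and K: "gap_horizon col clus K"
    and near: "\<And>i j. clus i = clus j \<Longrightarrow> \<bar>x $ i - x $ j\<bar> \<le> D"
    and static: "\<And>k. k \<le> K \<Longrightarrow> influence_graph R (partite_graph col)
      ((local_mean (cluster_graph col clus) ^^ k) x) = cluster_graph col clus"
  shows "influence_graph R (partite_graph col)
      ((local_mean (cluster_graph col clus) ^^ k) x) = cluster_graph col clus"
proof -
  define X where "X k = (local_mean (cluster_graph col clus) ^^ k) x" for k
  have hull: "\<bar>X k $ i - x $ j\<bar> \<le> D" if "clus i = clus j" for i j k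
    unfolding X_def using near that by (rule cluster_hull_invariant)
  have separated: "R < \<bar>X k $ i - X k $ j\<bar>" if "k \<le> K" "clus i \<noteq> clus j" "col i \<noteq> col j" for i j k
  proof -
    have "(i, j) \<notin> influence_graph R (partite_graph col) (X k)"
      using static[OF that(1)] that(2,3) by (auto simp: X_def cluster_graph_def)
    then show ?thesis using that by (simp add: influence_iff[OF assms(1)])
  qed
  \<comment> \<open>By symmetry it suffices to treat the case where the cluster of \<open>i\<close> lies below that of \<open>j\<close>.\<close>
  have ordered: False
    if "clus i \<noteq> clus j" "col i \<noteq> col j" "R < X 0 $ j - X 0 $ i" "\<bar>X k $ i - X k $ j\<bar> \<le> R" for i j
  proof -
    from K that(1,2) obtain k' i' j' where k': "k' \<le> K" "clus i' = clus i" "clus j' = clus j"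
      "col i' \<noteq> col j'" "X k $ i - X k $ j \<le> X k' $ i' - X k' $ j'"
      unfolding gap_horizon_def X_def by metis
    have "R < \<bar>X k' $ i' - X k' $ j'\<bar>" using separated k' that(1) by simp
    moreover have "X k' $ i' \<le> x $ i + D" "x $ j - D \<le> X k' $ j'"
      using hull[OF k'(2), of k'] hull[OF k'(3), of k'] by linarith+
    ultimately show False using that(3,4) k'(5) assms(1,2,3) by (simp add: X_def)
  qed
  have "(i, j) \<in> influence_graph R (partite_graph col) (X k) \<longleftrightarrow> (i, j) \<in> cluster_graph col clus" for i j
  proof (cases "clus i = clus j")
    case True
    then have "\<bar>X k $ i - X k $ j\<bar> \<le> R"
      using hull[of i i k] hull[of j i k] assms(2,3) by simp
    then show ?thesis using True by (simp add: influence_iff[OF assms(1)] cluster_graph_def)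
  next
    case False
    have "\<not> \<bar>X k $ i - X k $ j\<bar> \<le> R" if "col i \<noteq> col j"
    proof
      assume meet: "\<bar>X k $ i - X k $ j\<bar> \<le> R"
      have "R < \<bar>X 0 $ i - X 0 $ j\<bar>" using separated[of 0] False that by simp
      then consider "R < X 0 $ j - X 0 $ i" | "R < X 0 $ i - X 0 $ j" by linarith
      then show False
      proof cases
        case 1
        then show ?thesis using ordered[OF False that] meet by blast
      next
        case 2
        then show ?thesis using ordered[of j i] False that meet by (auto simp: abs_minus_commute)
      qed
    qed
    then show ?thesis using False by (auto simp: influence_iff[OF assms(1)] cluster_graph_def)
  qed
  then show ?thesis unfolding X_def by auto
qed


section \<open>Energy and quiet windows\<close>

definition hk_energy :: "real \<Rightarrow> ('n::finite \<times> 'n) set \<Rightarrow> real ^ 'n \<Rightarrow> real" where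
  "hk_energy R E x = (\<Sum>(i, j)\<in>E. min ((x $ i - x $ j)\<^sup>2) (R\<^sup>2))"

lemma hk_energy_nonneg: "0 \<le> hk_energy R E x"
  unfolding hk_energy_def by (rule sum_nonneg) auto

lemma hk_energy_le: "hk_energy R E x \<le> real (card E) * R\<^sup>2"
  unfolding hk_energy_def by (rule sum_bounded_above) auto

text \<open>
  Truncation makes the links outside the influence graph contribute the maximal value \<open>R\<^sup>2\<close>, which
  they cannot exceed after the step. So the decrease comes from the influence graph, where
  the untruncated energy drops.
\<close>

lemma hk_energy_drop:
  assumes "0 < R" "sym E" "refl E"
  shows "hk_energy R E (hk_update R E x) + 4 * (\<Sum>i\<in>UNIV. (x $ i - hk_update R E x $ i)\<^sup>2)
    \<le> hk_energy R E x"
proof -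
  define \<Gamma> where "\<Gamma> = influence_graph R E x"
  define y where "y = hk_update R E x"
  have sub: "\<Gamma> \<subseteq> E" by (auto simp: \<Gamma>_def influence_graph_def)
  have split: "(\<Sum>(i, j)\<in>E. f i j) = (\<Sum>(i, j)\<in>\<Gamma>. f i j) + (\<Sum>(i, j)\<in>E - \<Gamma>. f i j)" for f :: "'a \<Rightarrow> 'a \<Rightarrow> real"
    using sum.subset_diff[OF sub, of "\<lambda>(i, j). f i j"] by simp
  have "sym \<Gamma>" using assms(2) by (auto simp: \<Gamma>_def influence_graph_def sym_def abs_minus_commute)
  moreover have "refl \<Gamma>" using assms(1,3) by (auto simp: \<Gamma>_def influence_graph_def refl_on_def)
  ultimately have drop: "edge_energy \<Gamma> y + 4 * (\<Sum>i\<in>UNIV. (x $ i - y $ i)\<^sup>2) \<le> edge_energy \<Gamma> x"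
    using edge_energy_drop unfolding y_def hk_update_eq_local_mean \<Gamma>_def by blast
  have "(\<Sum>(i, j)\<in>\<Gamma>. min ((y $ i - y $ j)\<^sup>2) (R\<^sup>2)) \<le> edge_energy \<Gamma> y"
    unfolding edge_energy_def by (rule sum_mono) auto
  moreover have "(\<Sum>(i, j)\<in>E - \<Gamma>. min ((y $ i - y $ j)\<^sup>2) (R\<^sup>2)) \<le> (\<Sum>(i, j)\<in>E - \<Gamma>. R\<^sup>2)"
    by (rule sum_mono) auto
  ultimately have "hk_energy R E y \<le> edge_energy \<Gamma> y + (\<Sum>(i, j)\<in>E - \<Gamma>. R\<^sup>2)"
    unfolding hk_energy_def split by linarith
  moreover have "hk_energy R E x = edge_energy \<Gamma> x + (\<Sum>(i, j)\<in>E - \<Gamma>. R\<^sup>2)"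
  proof -
    have "(\<Sum>(i, j)\<in>\<Gamma>. min ((x $ i - x $ j)\<^sup>2) (R\<^sup>2)) = edge_energy \<Gamma> x"
      unfolding edge_energy_def
      by (rule sum.cong) (use assms(1) in \<open>auto simp: \<Gamma>_def influence_graph_def min_def abs_le_square_iff[symmetric]\<close>)
    moreover have "(\<Sum>(i, j)\<in>E - \<Gamma>. min ((x $ i - x $ j)\<^sup>2) (R\<^sup>2)) = (\<Sum>(i, j)\<in>E - \<Gamma>. R\<^sup>2)"
      by (rule sum.cong) (use assms(1) in \<open>auto simp: \<Gamma>_def influence_graph_def min_def abs_le_square_iff[symmetric] split: if_splits\<close>)
    ultimately show ?thesis unfolding hk_energy_def split by simp
  qed
  ultimately show ?thesis using drop unfolding y_def by linarith
qed

text \<open>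
  Otherwise each of the first \<open>B\<close> blocks of length \<open>L\<close> would contain a drop by \<open>c\<close>.
\<close>

lemma quiet_window:
  fixes v :: "nat \<Rightarrow> real"
  assumes "decseq v" "\<And>k. 0 \<le> v k" "v 0 < real B * c"
    and drop: "\<And>k. \<not> quiet k \<Longrightarrow> v (Suc k) + c \<le> v k"
  obtains b where "b < B" "\<And>k. k < L \<Longrightarrow> quiet (b * L + k)"
proof -
  have "\<exists>b<B. \<forall>k<L. quiet (b * L + k)"
  proof (rule ccontr)
    assume "\<not> (\<exists>b<B. \<forall>k<L. quiet (b * L + k))"
    then have loud: "\<exists>k<L. \<not> quiet (b * L + k)" if "b < B" for b using that by blast
    have "b \<le> B \<Longrightarrow> v (b * L) + real b * c \<le> v 0" for b
    proof (induction b)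
      case 0
      show ?case by simp
    next
      case (Suc b)
      then obtain k where k: "k < L" "\<not> quiet (b * L + k)" using loud[of b] by auto
      have "v (Suc b * L) \<le> v (Suc (b * L + k))" using k(1) by (intro decseqD[OF assms(1)]) simp
      moreover have "v (b * L + k) \<le> v (b * L)" by (intro decseqD[OF assms(1)]) simp
      ultimately show ?case using drop[OF k(2)] Suc by (simp add: algebra_simps)
    qed
    from this[of B] assms(2)[of "B * L"] assms(3) show False by simp
  qed
  then show thesis using that by blast
qed

section \<open>Uniform convergence\<close>

text \<open>
  After a quiet window that reaches the gap horizon, the influence graph is constant and each agent stays in
  the hull of its cluster. The number \<open>B\<close> of blocks is chosen before the initial state.
\<close>

lemma uniformly_Cauchy:
  fixes col :: "'n::finite \<Rightarrow> 'c"
  assumes R: "0 < R" and e: "0 < \<epsilon>"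
  shows "\<exists>N. \<forall>x k. N \<le> k \<longrightarrow>
    norm (hk_state R (partite_graph col) x k - hk_state R (partite_graph col) x N) < \<epsilon>"
proof -
  define E where "E = partite_graph col"
  define n where "n = real CARD('n)"
  have n: "1 \<le> n" by (simp add: n_def Suc_le_eq)
  \<comment> \<open>\<open>\<eta>\<close> bounds the edges in a quiet step, so a cluster has diameter at most \<open>2 * \<eta>\<close>;
    \<open>static_forever\<close> needs \<open>4 * (2 * \<eta>) < R\<close>, and two late states differ by at most \<open>4 * \<eta>\<close> per agent.\<close>
  define \<eta> where "\<eta> = min (R / 9) (\<epsilon> / (5 * n))"
  define \<delta> where "\<delta> = \<eta> / n\<^sup>2"
  have eta: "0 < \<eta>" "9 * \<eta> \<le> R" "4 * n * \<eta> < \<epsilon>"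
  proof -
    show "0 < \<eta>" using R e n by (simp add: \<eta>_def)
    show "9 * \<eta> \<le> R" by (simp add: \<eta>_def min_def)
    have "4 * n * \<eta> \<le> 4 * n * (\<epsilon> / (5 * n))" using n by (intro mult_left_mono) (auto simp: \<eta>_def)
    also have "\<dots> < \<epsilon>" using n e by simp
    finally show "4 * n * \<eta> < \<epsilon>" .
  qed
  have delta: "0 < \<delta>" "n * (n * \<delta>) = \<eta>" "\<delta> \<le> \<eta>"
  proof -
    show "0 < \<delta>" using eta n by (simp add: \<delta>_def)
    show eq: "n * (n * \<delta>) = \<eta>" using n by (simp add: \<delta>_def power2_eq_square)
    have "1 \<le> n\<^sup>2" using n by simp
    then show "\<delta> \<le> \<eta>" using eta(1) by (simp add: \<delta>_def divide_le_eq mult_le_cancel_left1)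
  qed
  obtain K where K: "\<And>clus :: 'n \<Rightarrow> 'n set. clusters col clus \<Longrightarrow> gap_horizon col clus K"
    using ex_uniform_gap_horizon by blast
  define L where "L = K + 1"
  obtain B where B: "real (card E) * R\<^sup>2 < real B * (4 * \<delta>\<^sup>2)"
    using ex_less_of_nat_mult[of "4 * \<delta>\<^sup>2" "real (card E) * R\<^sup>2"] delta(1) by auto
  have "norm (hk_state R E x k - hk_state R E x (B * L)) < \<epsilon>" if k: "B * L \<le> k" for x k
  proof -
    define X where "X = hk_state R E x"
    define \<Gamma> where "\<Gamma> k = influence_graph R E (X k)" for k
    have X_Suc: "X (Suc k) = local_mean (\<Gamma> k) (X k)" for k
      by (simp add: X_def hk_state_def \<Gamma>_def hk_update_eq_local_mean)
    have E: "sym E" "refl E" by (auto simp: E_def partite_graph_def sym_def refl_on_def)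
    define quiet where "quiet k \<longleftrightarrow> (\<forall>i. \<bar>X k $ i - X (Suc k) $ i\<bar> \<le> \<delta>)" for k
    define v where "v k = hk_energy R E (X k)" for k
    have drop: "v (Suc k) + 4 * (\<Sum>i\<in>UNIV. (X k $ i - X (Suc k) $ i)\<^sup>2) \<le> v k" for k
      using hk_energy_drop[OF R E, of "X k"] by (simp add: v_def X_def hk_state_def)
    obtain b where b: "b < B" "\<And>k. k < L \<Longrightarrow> quiet (b * L + k)"
    proof (rule quiet_window[of v B "4 * \<delta>\<^sup>2" quiet L])
      show "decseq v"
        using drop by (intro decseq_SucI) (smt (verit) sum_nonneg zero_le_power2)
      show "0 \<le> v k" for k by (simp add: v_def hk_energy_nonneg)
      show "v 0 < real B * (4 * \<delta>\<^sup>2)"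
        using hk_energy_le[of R E "X 0"] B by (simp add: v_def)
      fix k assume "\<not> quiet k"
      then obtain i where i: "\<delta> < \<bar>X k $ i - X (Suc k) $ i\<bar>" by (auto simp: quiet_def not_le)
      then have "\<delta>\<^sup>2 \<le> \<bar>X k $ i - X (Suc k) $ i\<bar>\<^sup>2" using delta(1) by (intro power_mono) auto
      also have "\<dots> \<le> (\<Sum>i\<in>UNIV. (X k $ i - X (Suc k) $ i)\<^sup>2)"
        unfolding power2_abs by (rule member_le_sum) auto
      finally show "v (Suc k) + 4 * \<delta>\<^sup>2 \<le> v k" using drop[of k] by linarith
    qed blast
    define t where "t = b * L"
    have quiet: "quiet (t + k)" if "k \<le> K" for k using b(2)[of k] that by (simp add: t_def L_def)
    have short: "\<bar>X k $ i - X k $ j\<bar> \<le> \<eta>" if "quiet k" "(i, j) \<in> \<Gamma> k" for i j k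
    proof -
      have "\<bar>X k $ i - X k $ j\<bar> \<le> n * (\<Sum>i\<in>UNIV. \<bar>X k $ i - X (Suc k) $ i\<bar>)"
        unfolding X_Suc n_def
        by (rule edge_length_le_step) (use that(2) in \<open>simp_all add: \<Gamma>_def E_def sym_influence refl_influence R\<close>)
      also have "\<dots> \<le> n * (n * \<delta>)"
        using that(1) n unfolding n_def quiet_def by (intro mult_left_mono sum_bounded_above) auto
      finally show ?thesis by (simp add: delta(2))
    qed
    obtain clus :: "'n \<Rightarrow> 'n set" where clus: "clusters col clus" "\<Gamma> t = cluster_graph col clus"
      "\<And>i j. clus i = clus j \<Longrightarrow> \<bar>X t $ i - X t $ j\<bar> \<le> 2 * \<eta>"
    proof (rule short_edges_imp_clusters[of R \<eta> col "X t"])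
      fix i j assume "(i, j) \<in> influence_graph R (partite_graph col) (X t)"
      then show "\<bar>X t $ i - X t $ j\<bar> \<le> \<eta>" using short[of t] quiet[of 0] by (simp add: \<Gamma>_def E_def)
    qed (use R eta in \<open>auto simp: \<Gamma>_def E_def\<close>)
    let ?M = "local_mean (cluster_graph col clus)"
    \<comment> \<open>In both states the links have length at most \<open>\<eta>\<close>, and one quiet step changes a length by
      at most \<open>2 * \<delta>\<close>, so no length crosses \<open>R\<close>.\<close>
    have same: "\<Gamma> (Suc k) = \<Gamma> k" if "quiet k" "quiet (Suc k)" for k
    proof -
      have "(i, j) \<in> \<Gamma> (Suc k) \<longleftrightarrow> (i, j) \<in> \<Gamma> k" for i j
      proof -
        have "\<bar>X k $ i - X (Suc k) $ i\<bar> \<le> \<delta>" "\<bar>X k $ j - X (Suc k) $ j\<bar> \<le> \<delta>"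
          using that(1) by (auto simp: quiet_def)
        then have "\<bar>X (Suc k) $ i - X (Suc k) $ j\<bar> \<le> \<eta> \<Longrightarrow> \<bar>X k $ i - X k $ j\<bar> \<le> R"
          "\<bar>X k $ i - X k $ j\<bar> \<le> \<eta> \<Longrightarrow> \<bar>X (Suc k) $ i - X (Suc k) $ j\<bar> \<le> R"
          using delta(3) eta(1,2) by linarith+
        then show ?thesis using short[OF that(1), of i j] short[OF that(2), of i j]
          unfolding \<Gamma>_def E_def influence_iff[OF R] by blast
      qed
      then show ?thesis by auto
    qed
    have G: "\<Gamma> (t + k) = cluster_graph col clus" if "k \<le> K" for k
      using that
    proof (induction k)
      case (Suc k)
      then show ?case using same[of "t + k"] quiet[of k] quiet[of "Suc k"] by simp
    qed (simp add: clus)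
    have X: "X (t + k) = (?M ^^ k) (X t)" if "k \<le> K" for k
      using that by (induction k) (simp_all add: X_Suc G)
    have static: "influence_graph R E ((?M ^^ k) (X t)) = cluster_graph col clus" for k
      unfolding E_def
    proof (rule static_forever[OF R _ _ K[OF clus(1)]])
      show "4 * (2 * \<eta>) < R" "0 \<le> 2 * \<eta>" using eta by linarith+
      show "\<bar>X t $ i - X t $ j\<bar> \<le> 2 * \<eta>" if "clus i = clus j" for i j using clus(3) that .
      show "influence_graph R (partite_graph col) ((?M ^^ k) (X t)) = cluster_graph col clus" if "k \<le> K" for k
        using G[OF that] X[OF that] by (simp add: \<Gamma>_def E_def)
    qed
    have X: "X (t + k) = (?M ^^ k) (X t)" for k
      by (induction k) (simp_all add: X_Suc \<Gamma>_def static)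
    have stay: "\<bar>X k $ i - X t $ i\<bar> \<le> 2 * \<eta>" if "t \<le> k" for i k
    proof -
      have "\<bar>(?M ^^ (k - t)) (X t) $ i - X t $ i\<bar> \<le> 2 * \<eta>"
        by (rule cluster_hull_invariant[OF clus(3)]) simp_all
      then show ?thesis using X[of "k - t"] that by simp
    qed
    have "t \<le> B * L" using b(1) by (simp add: t_def)
    have "norm (X k - X (B * L)) \<le> (\<Sum>i\<in>UNIV. \<bar>(X k - X (B * L)) $ i\<bar>)" by (rule norm_le_l1_cart)
    also have "\<dots> \<le> n * (4 * \<eta>)"
      unfolding n_def
    proof (rule sum_bounded_above)
      fix i
      show "\<bar>(X k - X (B * L)) $ i\<bar> \<le> 4 * \<eta>"
        using stay[of k i] stay[of "B * L" i] k \<open>t \<le> B * L\<close> by simp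
    qed
    finally show ?thesis using eta(3) by (simp add: X_def mult.assoc mult.left_commute)
  qed
  then show ?thesis unfolding E_def by blast
qed

lemma complete_partite_imp_partite_graph:
  assumes "complete_partite r E"
  obtains col :: "'n::finite \<Rightarrow> 'n set" where "E = partite_graph col"
proof -
  obtain P where P: "partition_on UNIV P" "\<And>i. (i, i) \<in> E"
    "\<And>i j. i \<noteq> j \<Longrightarrow> (i, j) \<in> E \<longleftrightarrow> \<not> (\<exists>V\<in>P. i \<in> V \<and> j \<in> V)"
    using assms unfolding complete_partite_def by (elim exE conjE) (rule that; simp)
  have "\<exists>V\<in>P. i \<in> V" for i using partition_onD1[OF P(1)] by blast
  then obtain col where col: "\<And>i. col i \<in> P" "\<And>i. i \<in> col i" by metis
  have unique: "V = W" if "V \<in> P" "W \<in> P" "i \<in> V" "i \<in> W" for i V W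
    using disjointD[OF partition_onD2[OF P(1)] that(1,2)] that(3,4) by blast
  have "(\<exists>V\<in>P. i \<in> V \<and> j \<in> V) \<longleftrightarrow> col i = col j" for i j
  proof
    assume "\<exists>V\<in>P. i \<in> V \<and> j \<in> V"
    then obtain V where "V \<in> P" "i \<in> V" "j \<in> V" by blast
    then show "col i = col j"
      using unique[OF col(1) _ col(2), of V i] unique[OF col(1) _ col(2), of V j] by simp
  next
    assume "col i = col j"
    then show "\<exists>V\<in>P. i \<in> V \<and> j \<in> V" using col(1)[of i] col(2)[of i] col(2)[of j] by auto
  qed
  with P(2,3) have "(i, j) \<in> E \<longleftrightarrow> (i, j) \<in> partite_graph col" for i j
    by (cases "i = j") (simp_all add: partite_graph_def)
  then have "E = partite_graph col" by auto
  then show thesis by (rule that)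
qed

theorem proposition7:
  fixes R \<epsilon> :: real and r :: nat and E :: "('n::finite \<times> 'n) set"
  assumes "R > 0" and "\<epsilon> > 0"
    and "r \<in> {1..CARD('n)}" and "complete_partite r E"
  shows "max_convergence_time R \<epsilon> E < \<infinity>"
proof -
  obtain col :: "'n \<Rightarrow> 'n set" where E: "E = partite_graph col"
    by (rule complete_partite_imp_partite_graph[OF assms(4)])
  have near: "\<exists>N. \<forall>x k. N \<le> k \<longrightarrow> norm (hk_state R E x k - hk_state R E x N) < e" if "0 < e" for e
    unfolding E by (rule uniformly_Cauchy[OF assms(1) that])
  have lim: "hk_state R E x \<longlonglongrightarrow> steady_state R E x" for x
  proof -
    have "Cauchy (hk_state R E x)"
      unfolding Cauchy_altdef2 dist_norm using near by meson
    then show ?thesis by (simp add: steady_state_def Cauchy_convergent_iff convergent_LIMSEQ_iff)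
  qed
  obtain N where N: "\<And>x k. N \<le> k \<Longrightarrow> norm (hk_state R E x k - hk_state R E x N) < \<epsilon> / 3"
    using near[of "\<epsilon> / 3"] assms(2) by auto
  have "convergence_time R \<epsilon> E x \<le> enat N" for x
  proof -
    have "norm (steady_state R E x - hk_state R E x N) \<le> \<epsilon> / 3"
    proof (rule tendsto_upperbound)
      show "(\<lambda>k. norm (hk_state R E x k - hk_state R E x N)) \<longlonglongrightarrow> norm (steady_state R E x - hk_state R E x N)"
        by (intro tendsto_intros lim)
      show "\<forall>\<^sub>F k in sequentially. norm (hk_state R E x k - hk_state R E x N) \<le> \<epsilon> / 3"
        using N by (auto simp: eventually_sequentially intro: less_imp_le)
    qed simp
    then have "norm (hk_state R E x k - steady_state R E x) < \<epsilon>" if "N \<le> k" for k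
      using N[OF that, of x] norm_triangle_ineq4[of "hk_state R E x k - hk_state R E x N" "steady_state R E x - hk_state R E x N"]
        assms(2) by simp
    then show ?thesis unfolding convergence_time_def by (intro Inf_lower) auto
  qed
  then have "max_convergence_time R \<epsilon> E \<le> enat N"
    unfolding max_convergence_time_def by (intro SUP_least)
  then show ?thesis by (rule le_less_trans) simp
qed

end
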